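(* Let $p\in[0,1]$ and let $\check S$ be the random walk with counterbalanced steps with innovation parameter $p$ and step law $\mu$. If $X_1\in L^1(\mathbb{P})$, with $m_1=\mathbb{E}(X_1)$, then $$\lim_{n\to\infty}\frac{\check S(n)}{n}=\frac{p}{2-p}\,m_1\qquad\text{in probability.}$$
   Context: Let $\mu$ be a probability law on $\mathbb{R}$ and $p\in[0,1]$. Let $(X_n)_{n\ge1}$ be i.i.d. real random variables with law $\mu$; let $(\varepsilon_n)_{n\ge2}$ be i.i.d. Bernoulli variables with $\mathbb{P}(\varepsilon_n=1)=p$, $\mathbb{P}(\varepsilon_n=0)=1-p$, and set $\varepsilon_1=1$; let $(v(n))_{n\ge2}$ be independent random variables with $v(n)$ uniform on $\{1,\dots,n-1\}$. The three sequences $(X_n)$, $(\varepsilon_n)$, $(v(n))$ are independent of each other. Put $\mathrm{i}(n)=\sum_{j=1}^n\varepsilon_j$ for $n\ge1$. The counterbalanced sequence $(\check X_n)_{n\ge1}$ is defined recursively by $\check X_n=X_{\mathrm{i}(n)}$ if $\varepsilon_n=1$ (in particular $\check X_1=X_1$), and $\check X_n=-\check X_{v(n)}$ if $\varepsilon_n=0$. The random walk with counterbalanced steps is $\check S(n)=\check X_1+\cdots+\check X_n$, $n\ge0$. *)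

theory Defs
  imports "HOL-Probability.Probability"
begin

(* The measurability conjuncts are needed because "measure" is 0 on non-measurable sets. *)
definition tendsto_in_probability ::
  "'a measure \<Rightarrow> (nat \<Rightarrow> 'a \<Rightarrow> real) \<Rightarrow> ('a \<Rightarrow> real) \<Rightarrow> bool" where
  "tendsto_in_probability M Y Z \<longleftrightarrow>
     (\<forall>n. Y n \<in> borel_measurable M) \<and> Z \<in> borel_measurable M \<and>
     (\<forall>\<delta>>0. (\<lambda>n. measure M {\<omega> \<in> space M. \<bar>Y n \<omega> - Z \<omega>\<bar> > \<delta>}) \<longlonglongrightarrow> 0)"

definition innovation_count :: "(nat \<Rightarrow> nat) \<Rightarrow> nat \<Rightarrow> nat" where
  "innovation_count \<epsilon> n = (\<Sum>j=1..n. \<epsilon> j)"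

(* Pathwise recursion on realisations x, \<epsilon>, v of the three sequences. The last branch is a
   dummy value that makes the recursion total: for n >= 1 it is reached only if \<epsilon> n \<noteq> 1 and
   v n is outside {1..n-1}, which has probability 0 under counterbalanced_setting. *)
function counterbalanced_step ::
  "(nat \<Rightarrow> real) \<Rightarrow> (nat \<Rightarrow> nat) \<Rightarrow> (nat \<Rightarrow> nat) \<Rightarrow> nat \<Rightarrow> real" where
  "counterbalanced_step x \<epsilon> v n =
     (if \<epsilon> n = 1 then x (innovation_count \<epsilon> n)
      else if 1 \<le> v n \<and> v n < n then - counterbalanced_step x \<epsilon> v (v n)
      else 0)"
  by pat_completeness auto
termination
  by (relation "Wellfounded.measure (\<lambda>(x, \<epsilon>, v, n). n)") auto

declare counterbalanced_step.simps [simp del]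

definition counterbalanced_walk ::
  "(nat \<Rightarrow> 'a \<Rightarrow> real) \<Rightarrow> (nat \<Rightarrow> 'a \<Rightarrow> nat) \<Rightarrow> (nat \<Rightarrow> 'a \<Rightarrow> nat) \<Rightarrow> nat \<Rightarrow> 'a \<Rightarrow> real" where
  "counterbalanced_walk X \<epsilon> v n \<omega> =
     (\<Sum>k=1..n. counterbalanced_step (\<lambda>j. X j \<omega>) (\<lambda>j. \<epsilon> j \<omega>) (\<lambda>j. v j \<omega>) k)"

definition sequence_sigma ::
  "'a measure \<Rightarrow> nat set \<Rightarrow> 'b measure \<Rightarrow> (nat \<Rightarrow> 'a \<Rightarrow> 'b) \<Rightarrow> 'a set set" where
  "sequence_sigma M I N Y =
     sets (vimage_algebra (space M) (\<lambda>\<omega>. \<lambda>n\<in>I. Y n \<omega>) (PiM I (\<lambda>_. N)))"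

(* The mutual independence of the three sequences is stated through the sigma-algebras they
   generate (indep_seq), since indep_vars requires all variables to have the same value type. *)
locale counterbalanced_setting = prob_space M
  for M :: "'a measure" +
  fixes \<mu> :: "real measure"
    and p :: real
    and X :: "nat \<Rightarrow> 'a \<Rightarrow> real"
    and \<epsilon> :: "nat \<Rightarrow> 'a \<Rightarrow> nat"
    and v :: "nat \<Rightarrow> 'a \<Rightarrow> nat"
  assumes law: "real_distribution \<mu>"
    and p_range: "p \<in> {0..1}"
    and X_indep: "indep_vars (\<lambda>_. borel) X {1..}"
    and X_law: "\<And>n. n \<ge> 1 \<Longrightarrow> distr M borel (X n) = \<mu>"
    and eps_first: "\<And>\<omega>. \<omega> \<in> space M \<Longrightarrow> \<epsilon> 1 \<omega> = 1"
    and eps_indep: "indep_vars (\<lambda>_. count_space UNIV) \<epsilon> {2..}"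
    and eps_law: "\<And>n. n \<ge> 2 \<Longrightarrow>
          distr M (count_space UNIV) (\<epsilon> n) = measure_pmf (map_pmf of_bool (bernoulli_pmf p))"
    and v_indep: "indep_vars (\<lambda>_. count_space UNIV) v {2..}"
    and v_law: "\<And>n. n \<ge> 2 \<Longrightarrow>
          distr M (count_space UNIV) (v n) = measure_pmf (pmf_of_set {1..n - 1})"
    and indep_seq: "indep_sets
          (\<lambda>k. [sequence_sigma M {1..} borel X,
                sequence_sigma M {2..} (count_space UNIV) \<epsilon>,
                sequence_sigma M {2..} (count_space UNIV) v] ! k) {..<3::nat}"

end

(* The walk is linear in the steps: S(n) = sum_j W_j(n) X_j, where the weights W_j(n) depend only
   on the innovations and the choices and are walks with counterbalanced steps started from unit
   sequences. Let D(n) = sum_j W_j(n) and c = p/(2-p), the solution of p - (1-p) c = c.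
   Conditionally on the past, the increments of W_j(n) and of D(n) - c n have, whenever the process
   is off zero, mean -(1-p)/n times the current value. The cross terms in the second moments are
   therefore nonpositive, which gives sum_j E W_j(n)^2 <= n and E (D(n) - c n)^2 <= 4 n.
   For |X| <= K this yields E |S(n) - c n m| <= 4 K sqrt n. Since sum_j |W_j(n)| <= n, truncating X
   at level K costs at most 2 n E(|X|; |X| > K) in L1, so the convergence even holds in L1. *)
theory Submission
  imports Defs
begin

text \<open>Plain second moments suffice because of the sign flip: a copied step tends to oppose the
  current value, so no growth-rate estimate is needed. Both second moment bounds are instances of
  one estimate for \<open>det_walk x n \<omega> - a * n\<close>. It asks only that multiplying this
  quantity by the value of the next innovation has the effect of multiplying it by a constant
  \<open>b\<close>. For the weight of a label, a = b = 0, since the weight vanishes until that label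
  has been drawn; for the all-ones sequence, b = 1 and a = c. No conditional expectation is formed.
  Each one is replaced by a product rule for functions of disjoint groups of sources, a source being
  the events generated by a single variable. The obstacle is that independence is given in two
  layers, inside each sequence and between the three generated sigma-algebras, whereas the argument
  separates single variables of different sequences. The two layers have to be merged into
  independence of one family. The sum over labels is taken before steps are estimated: a step
  descends from at most one innovation, and this keeps the total of the squares linear in n.\<close>

section \<open>Independence of grouped sources\<close>

text \<open>Converse to grouping: a finite intersection splits into one block per group, each block
  lies in the sigma-algebra generated by its group, so the outer independence multiplies over blocks
  and the inner one factors each block.\<close>

lemma (in prob_space) indep_sets_UN:
  assumes fin: "finite J" and disj: "disjoint_family_on I J"
    and inner: "\<And>k. k \<in> J \<Longrightarrow> indep_sets E (I k)"
    and outer: "indep_sets (\<lambda>k. sigma_sets (space M) (\<Union>i\<in>I k. E i)) J"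
  shows "indep_sets E (\<Union>k\<in>J. I k)"
proof (rule indep_setsI)
  have E_events: "E i \<subseteq> events" if "k \<in> J" "i \<in> I k" for i k
    using inner[OF that(1)] that(2) by (auto simp: indep_sets_def)
  then show "E i \<subseteq> events" if "i \<in> (\<Union>k\<in>J. I k)" for i
    using that by auto
  fix A L assume L: "L \<noteq> {}" "L \<subseteq> (\<Union>k\<in>J. I k)" "finite L" and A: "\<forall>i\<in>L. A i \<in> E i"
  have A_events: "A i \<in> events" if "i \<in> L" for i
    using that L(2) A E_events by blast
  \<comment> \<open>A group that \<open>L\<close> does not meet must contribute an event of
    probability 1, matching the empty product; the empty intersection would be \<open>UNIV\<close>,
    hence the case distinction.\<close>
  define B where "B k = (if L \<inter> I k = {} then space M else (\<Inter>i\<in>L \<inter> I k. A i))" for k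
  have B_sets: "B k \<in> sigma_sets (space M) (\<Union>i\<in>I k. E i)" if k: "k \<in> J" for k
  proof -
    interpret sigma_algebra "space M" "sigma_sets (space M) (\<Union>i\<in>I k. E i)"
      by (rule sigma_algebra_sigma_sets) (use E_events[OF k] sets.sets_into_space in blast)
    have "(\<Inter>i\<in>L \<inter> I k. A i) \<in> sigma_sets (space M) (\<Union>i\<in>I k. E i)" if "L \<inter> I k \<noteq> {}"
      using that L(3) A by (intro finite_INT sigma_sets.Basic) blast+
    then show ?thesis
      unfolding B_def by auto
  qed
  have B_prob: "prob (B k) = (\<Prod>i\<in>L \<inter> I k. prob (A i))" if "k \<in> J" for k
    unfolding B_def using indep_setsD[OF inner[OF that], of "L \<inter> I k" A] L(3) A
    by (auto simp: prob_space)
  have "J \<noteq> {}" using L by auto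
  have "(\<Inter>i\<in>L. A i) = (\<Inter>k\<in>J. B k)"
  proof (intro equalityI subsetI)
    fix x assume x: "x \<in> (\<Inter>i\<in>L. A i)"
    then have "x \<in> space M"
      using L(1) A_events sets.sets_into_space by blast
    with x show "x \<in> (\<Inter>k\<in>J. B k)"
      by (auto simp: B_def)
  next
    fix x assume x: "x \<in> (\<Inter>k\<in>J. B k)"
    show "x \<in> (\<Inter>i\<in>L. A i)"
    proof
      fix i assume "i \<in> L"
      with L(2) obtain k where "k \<in> J" "i \<in> I k" by auto
      then have "x \<in> B k" and "B k \<subseteq> A i"
        using x \<open>i \<in> L\<close> by (auto simp: B_def)
      then show "x \<in> A i" ..
    qed
  qed
  then have "prob (\<Inter>i\<in>L. A i) = (\<Prod>k\<in>J. prob (B k))"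
    using indep_setsD[OF outer subset_refl \<open>J \<noteq> {}\<close> fin] B_sets by simp
  also have "\<dots> = (\<Prod>k\<in>J. \<Prod>i\<in>L \<inter> I k. prob (A i))"
    using B_prob by simp
  also have "\<dots> = (\<Prod>i\<in>(\<Union>k\<in>J. L \<inter> I k). prob (A i))"
    using fin L(3) disj by (intro prod.UNION_disjoint[symmetric]) (auto simp: disjoint_family_on_def)
  also have "(\<Union>k\<in>J. L \<inter> I k) = L"
    using L(2) by auto
  finally show "prob (\<Inter>i\<in>L. A i) = (\<Prod>i\<in>L. prob (A i))" .
qed

text \<open>Independent pi-systems generate independent sigma-algebras, so functions of two disjoint
  groups of sources are independent variables. This product rule does the work of conditioning on
  the past.\<close>

lemma (in prob_space) expectation_mult_disjoint_sources:
  fixes f g :: "'a \<Rightarrow> real"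
  assumes indep: "indep_sets E (I \<union> J)" and disj: "I \<inter> J = {}"
    and stable: "\<And>i. i \<in> I \<union> J \<Longrightarrow> Int_stable (E i)"
    and f: "f \<in> borel_measurable (sigma (space M) (\<Union>i\<in>I. E i))" "integrable M f"
    and g: "g \<in> borel_measurable (sigma (space M) (\<Union>i\<in>J. E i))" "integrable M g"
  shows "integrable M (\<lambda>\<omega>. f \<omega> * g \<omega>)"
    and "expectation (\<lambda>\<omega>. f \<omega> * g \<omega>) = expectation f * expectation g"
proof -
  have E_events: "E i \<subseteq> events" if "i \<in> I \<union> J" for i
    using indep that by (auto simp: indep_sets_def)
  have sets_gen: "sets (sigma (space M) (\<Union>i\<in>K. E i)) = sigma_sets (space M) (\<Union>i\<in>K. E i)"
    if "K \<subseteq> I \<union> J" for K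
    using that E_events sets.sets_into_space by (intro sets_measure_of) blast
  have "indep_sets (\<lambda>b. sigma_sets (space M) (\<Union>i\<in>case_bool I J b. E i)) UNIV"
  proof (rule indep_sets_collect_sigma)
    show "indep_sets E (\<Union>b\<in>UNIV. case_bool I J b)"
      using indep by (simp add: UNIV_bool Un_commute)
    show "disjoint_family_on (case_bool I J) UNIV"
      using disj by (auto simp: disjoint_family_on_def split: bool.split)
  qed (use stable in \<open>auto split: bool.splits\<close>)
  then have blocks: "indep_set (sigma_sets (space M) (\<Union>i\<in>I. E i)) (sigma_sets (space M) (\<Union>i\<in>J. E i))"
    unfolding indep_set_def by (rule indep_sets_mono_sets) (auto split: bool.splits)
  have gen: "sigma_sets (space M) {h -` A \<inter> space M |A. A \<in> sets borel} \<subseteq> sigma_sets (space M) (\<Union>i\<in>K. E i)"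
    if "K \<subseteq> I \<union> J" "h \<in> borel_measurable (sigma (space M) (\<Union>i\<in>K. E i))" for K and h :: "'a \<Rightarrow> real"
  proof (rule sigma_sets_mono, clarify)
    fix A :: "real set" assume "A \<in> sets borel"
    from measurable_sets[OF that(2) this] sets_gen[OF that(1)]
    show "h -` A \<inter> space M \<in> sigma_sets (space M) (\<Union>i\<in>K. E i)"
      by (simp add: space_measure_of_conv)
  qed
  have "indep_set (sigma_sets (space M) {f -` A \<inter> space M |A. A \<in> sets borel})
      (sigma_sets (space M) {g -` A \<inter> space M |A. A \<in> sets borel})"
    using blocks gen[OF _ f(1)] gen[OF _ g(1)] unfolding indep_sets2_eq by blast
  then have "indep_var borel f borel g"
    unfolding indep_var_eq using f(2) g(2) by auto
  then show "integrable M (\<lambda>\<omega>. f \<omega> * g \<omega>)"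
    and "expectation (\<lambda>\<omega>. f \<omega> * g \<omega>) = expectation f * expectation g"
    using indep_var_integrable indep_var_lebesgue_integral f(2) g(2) by auto
qed

lemma Int_stable_vimages: "Int_stable {Y -` A \<inter> S |A. A \<in> sets N}"
  unfolding Int_stable_def
proof clarify
  fix A B assume "A \<in> sets N" "B \<in> sets N"
  then show "\<exists>C. Y -` A \<inter> S \<inter> (Y -` B \<inter> S) = Y -` C \<inter> S \<and> C \<in> sets N"
    by (intro exI[of _ "A \<inter> B"]) auto
qed

lemma vimage_in_sequence_sigma:
  assumes "j \<in> I" "B \<in> sets N" "\<And>i. i \<in> I \<Longrightarrow> Y i \<in> space M \<rightarrow> space N"
  shows "Y j -` B \<inter> space M \<in> sequence_sigma M I N Y"
proof -
  have "(\<lambda>\<omega>. \<lambda>n\<in>I. Y n \<omega>) \<in> space M \<rightarrow> space (Pi\<^sub>M I (\<lambda>_. N))"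
    using assms(3) by (auto simp: space_PiM Pi_iff)
  from measurable_vimage_algebra1[OF this]
  have "(\<lambda>\<omega>. (\<lambda>n\<in>I. Y n \<omega>) j) \<in> measurable (vimage_algebra (space M) (\<lambda>\<omega>. \<lambda>n\<in>I. Y n \<omega>) (Pi\<^sub>M I (\<lambda>_. N))) N"
    by (rule measurable_compose) (use assms(1) in simp)
  from measurable_sets[OF this assms(2)] show ?thesis
    using assms(1) by (simp add: sequence_sigma_def)
qed

lemma (in prob_space) indep_sets_reindex:
  assumes "inj_on h J" "indep_sets (\<lambda>j. E (h j)) J"
  shows "indep_sets E (h ` J)"
proof (rule indep_setsI)
  show "E i \<subseteq> events" if "i \<in> h ` J" for i
    using that assms(2) by (auto simp: indep_sets_def)
  fix A L assume L: "L \<noteq> {}" "L \<subseteq> h ` J" "finite L" and A: "\<forall>i\<in>L. A i \<in> E i"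
  obtain K where K: "K \<subseteq> J" "L = h ` K" "finite K"
    using finite_subset_image[OF L(3,2)] by auto
  have inj: "inj_on h K"
    using assms(1) K(1) by (rule inj_on_subset)
  have "prob (\<Inter>j\<in>K. A (h j)) = (\<Prod>j\<in>K. prob (A (h j)))"
    using L A K by (intro indep_setsD[OF assms(2)]) auto
  then show "prob (\<Inter>i\<in>L. A i) = (\<Prod>i\<in>L. prob (A i))"
    unfolding K(2) by (simp add: prod.reindex[OF inj])
qed

section \<open>Pathwise properties of counterbalanced steps\<close>

text \<open>Turns the branching recursion into sums of products with indicators, to which a product
  rule for expectations applies. If step \<open>Suc n\<close> is an innovation, its label is one
  more than the count at time \<open>n\<close>, hence a function of the past alone. A choice outside
  1..n makes every indicator vanish, in agreement with the dummy value 0.\<close>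

lemma step_Suc:
  "counterbalanced_step x e w (Suc n) =
     of_bool (e (Suc n) = 1) * x (Suc (innovation_count e n)) -
     (\<Sum>k=1..n. of_bool (e (Suc n) \<noteq> 1) * (of_bool (w (Suc n) = k) * counterbalanced_step x e w k))"
proof -
  have "innovation_count e (Suc n) = Suc (innovation_count e n)" if "e (Suc n) = 1"
    using that by (simp add: innovation_count_def)
  moreover have "(\<Sum>k=1..n. of_bool (w (Suc n) = k) * counterbalanced_step x e w k) =
      (if 1 \<le> w (Suc n) \<and> w (Suc n) < Suc n then counterbalanced_step x e w (w (Suc n)) else 0)"
    by (simp add: of_bool_def if_distrib[of "\<lambda>a. a * _"] cong: if_cong)
  ultimately show ?thesis
    by (subst counterbalanced_step.simps) auto
qed

text \<open>Serves two purposes: over the whole space with random values, and over the sigma-algebra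
  of the past with constant ones. Hence \<open>N\<close> is arbitrary and \<open>e\<close>,
  \<open>w\<close> are constrained only up to time \<open>n\<close>. The choices start at 2 because
  the sum over earlier steps is empty at time 1.\<close>

lemma measurable_step:
  assumes X: "\<And>j. j \<ge> 1 \<Longrightarrow> X j \<in> borel_measurable N"
    and e: "\<And>j. 1 \<le> j \<Longrightarrow> j \<le> n \<Longrightarrow> e j \<in> measurable N (count_space UNIV)"
    and w: "\<And>j. 2 \<le> j \<Longrightarrow> j \<le> n \<Longrightarrow> w j \<in> measurable N (count_space UNIV)"
    and n: "1 \<le> k" "k \<le> n"
  shows "(\<lambda>\<omega>. counterbalanced_step (\<lambda>j. X j \<omega>) (\<lambda>j. e j \<omega>) (\<lambda>j. w j \<omega>) k) \<in> borel_measurable N"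
  using n
proof (induction k rule: less_induct)
  case (less k)
  then obtain m where m: "k = Suc m" by (cases k) auto
  have "(\<lambda>\<omega>. innovation_count (\<lambda>j. e j \<omega>) m) \<in> measurable N (count_space UNIV)"
    unfolding innovation_count_def using less.prems m by (intro measurable_sum_nat e) auto
  then have 1: "(\<lambda>\<omega>. X (Suc (innovation_count (\<lambda>j. e j \<omega>) m)) \<omega>) \<in> borel_measurable N"
    by (rule measurable_compose_countable[rotated, where f = "\<lambda>i. X (Suc i)"]) (use X in auto)
  have e_Suc: "e (Suc m) \<in> measurable N (count_space UNIV)"
    using e less.prems m by auto
  have 3: "(\<lambda>\<omega>. of_bool (e (Suc m) \<omega> = 1) :: real) \<in> borel_measurable N"
    by (rule measurable_compose[OF e_Suc]) simp
  have 4: "(\<lambda>\<omega>. of_bool (e (Suc m) \<omega> \<noteq> 1) :: real) \<in> borel_measurable N"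
    by (rule measurable_compose[OF e_Suc]) simp
  have 2: "(\<lambda>\<omega>. of_bool (w (Suc m) \<omega> = l) * counterbalanced_step (\<lambda>j. X j \<omega>) (\<lambda>j. e j \<omega>) (\<lambda>j. w j \<omega>) l)
      \<in> borel_measurable N" if l: "l \<in> {1..m}" for l
  proof (rule borel_measurable_times)
    have "w (Suc m) \<in> measurable N (count_space UNIV)"
      using w less.prems m l by auto
    then show "(\<lambda>\<omega>. of_bool (w (Suc m) \<omega> = l) :: real) \<in> borel_measurable N"
      by (rule measurable_compose) simp
    show "(\<lambda>\<omega>. counterbalanced_step (\<lambda>j. X j \<omega>) (\<lambda>j. e j \<omega>) (\<lambda>j. w j \<omega>) l) \<in> borel_measurable N"
      using less.IH[of l] l m less.prems by auto
  qed
  show ?case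
    unfolding m step_Suc
    by (rule borel_measurable_diff[OF borel_measurable_times[OF 3 1]
        borel_measurable_sum[OF borel_measurable_times[OF 4 2]]])
qed

lemma abs_step_le:
  assumes "B \<ge> 0" "\<And>j. \<bar>x j\<bar> \<le> B"
  shows "\<bar>counterbalanced_step x e w k\<bar> \<le> B"
proof (induction k rule: less_induct)
  case (less k)
  then show ?case
    using assms by (subst counterbalanced_step.simps) auto
qed

text \<open>Fed with this sequence, the recursion traces genealogy: step k becomes 1 or -1 if it
  goes back to the innovation labelled \<open>j\<close>, with the sign given by the parity of the
  number of copyings, and 0 otherwise.\<close>

abbreviation unit_seq :: "nat \<Rightarrow> nat \<Rightarrow> real" where
  "unit_seq j \<equiv> (\<lambda>i. of_bool (i = j))"

lemma innovation_count_mono: "m \<le> n \<Longrightarrow> innovation_count e m \<le> innovation_count e n"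
  unfolding innovation_count_def by (rule sum_mono2) auto

text \<open>Ancestors of a step are no later than the step itself, so a label not yet drawn cannot
  occur among them.\<close>

lemma step_unit_seq_eq_0:
  "innovation_count e k < j \<Longrightarrow> counterbalanced_step (unit_seq j) e w k = 0"
proof (induction k rule: less_induct)
  case (less k)
  then show ?case
    using innovation_count_mono[of "w k" k e] by (subst counterbalanced_step.simps) auto
qed

text \<open>Each step has at most one innovation as its origin, and copying changes only the
  sign.\<close>

lemma sum_abs_step_unit_seq_le:
  assumes "finite J"
  shows "(\<Sum>j\<in>J. \<bar>counterbalanced_step (unit_seq j) e w k\<bar>) \<le> 1"
proof (induction k rule: less_induct)
  case (less k)
  consider "e k = 1" | "e k \<noteq> 1" "1 \<le> w k \<and> w k < k" | "e k \<noteq> 1" "\<not> (1 \<le> w k \<and> w k < k)"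
    by blast
  then show ?case
  proof cases
    case 1
    then have "(\<Sum>j\<in>J. \<bar>counterbalanced_step (unit_seq j) e w k\<bar>) = (\<Sum>j\<in>J. of_bool (innovation_count e k = j))"
      by (subst counterbalanced_step.simps) simp
    also have "\<dots> \<le> 1"
      using assms by (simp add: of_bool_def)
    finally show ?thesis .
  next
    case 2
    then have "counterbalanced_step x e w k = - counterbalanced_step x e w (w k)" for x
      by (subst counterbalanced_step.simps) simp
    then show ?thesis
      using less.IH[of "w k"] 2 by simp
  next
    case 3
    then have "counterbalanced_step x e w k = 0" for x
      by (subst counterbalanced_step.simps) auto
    then show ?thesis
      by simp
  qed
qed

lemma step_eq_sum_unit_seq:
  assumes e: "\<And>j. j \<ge> 1 \<Longrightarrow> e j \<le> 1" and "1 \<le> k" "k \<le> n"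
  shows "counterbalanced_step x e w k = (\<Sum>j=1..n. x j * counterbalanced_step (unit_seq j) e w k)"
  using assms(2,3)
proof (induction k rule: less_induct)
  case (less k)
  consider "e k = 1" | "e k \<noteq> 1" "1 \<le> w k \<and> w k < k" | "e k \<noteq> 1" "\<not> (1 \<le> w k \<and> w k < k)"
    by blast
  then show ?case
  proof cases
    case 1
    \<comment> \<open>The label of an innovation at time \<open>k\<close> lies in 1..k: the step
      itself contributes 1 to the count, and no step contributes more. The range 1..n does not
      depend on \<open>k\<close>, so that sums over steps and labels can later be exchanged.\<close>
    have "innovation_count e k \<le> (\<Sum>j=1..k. 1)"
      unfolding innovation_count_def using e by (intro sum_mono) auto
    moreover have "e k \<le> innovation_count e k"
      unfolding innovation_count_def using less.prems by (intro member_le_sum) auto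
    ultimately have "innovation_count e k \<in> {1..n}"
      using 1 less.prems by auto
    moreover have "(\<Sum>j=1..n. x j * counterbalanced_step (unit_seq j) e w k) =
        (\<Sum>j=1..n. if innovation_count e k = j then x j else 0)"
      using 1 by (intro sum.cong refl) (subst counterbalanced_step.simps, simp)
    ultimately show ?thesis
      using 1 by (subst counterbalanced_step.simps) simp
  next
    case 2
    have "(\<Sum>j=1..n. x j * counterbalanced_step (unit_seq j) e w k) =
        (\<Sum>j=1..n. - (x j * counterbalanced_step (unit_seq j) e w (w k)))"
      using 2 by (intro sum.cong refl) (subst counterbalanced_step.simps, simp)
    also have "\<dots> = - counterbalanced_step x e w (w k)"
      using 2 less by (simp add: sum_negf)
    finally show ?thesis
      using 2 by (subst counterbalanced_step.simps) simp
  next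
    case 3
    then have "counterbalanced_step y e w k = 0" for y
      by (subst counterbalanced_step.simps) auto
    then show ?thesis
      by simp
  qed
qed

section \<open>Moment bounds\<close>

context counterbalanced_setting
begin

text \<open>In the index (k, j), k names the sequence (0 for \<open>X\<close>, 1 for
  \<open>\<epsilon>\<close>, 2 for \<open>v\<close>) and j the time. Passing from variables to set
  systems puts real-valued and integer-valued variables into one family.\<close>

definition source :: "nat \<times> nat \<Rightarrow> 'a set set" where
  "source = (\<lambda>(k, j).
     if k = 0 then {X j -` A \<inter> space M |A. A \<in> sets borel}
     else if k = 1 then {\<epsilon> j -` A \<inter> space M |A. A \<in> sets (count_space UNIV)}
     else {v j -` A \<inter> space M |A. A \<in> sets (count_space UNIV)})"

abbreviation all_sources :: "(nat \<times> nat) set" where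
  "all_sources \<equiv> {0} \<times> {1..} \<union> {1, 2} \<times> {2..}"

text \<open>The sigma-algebra generated by a group of sources, encoded as a measure so that
  measurability of functions with respect to it can be stated.\<close>

definition info :: "(nat \<times> nat) set \<Rightarrow> 'a measure" where
  "info K = sigma (space M) (\<Union>i\<in>K. source i)"

lemma measurable_sequences [measurable]:
  shows "j \<ge> 1 \<Longrightarrow> X j \<in> borel_measurable M"
    and "j \<ge> 2 \<Longrightarrow> \<epsilon> j \<in> measurable M (count_space UNIV)"
    and "j \<ge> 2 \<Longrightarrow> v j \<in> measurable M (count_space UNIV)"
  using X_indep eps_indep v_indep by (auto simp: indep_vars_def)

lemma Int_stable_source: "Int_stable (source i)"
  by (cases i) (auto simp: source_def intro: Int_stable_vimages[where N = borel]
      Int_stable_vimages[where N = "count_space UNIV", simplified])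

text \<open>The two layers of the hypotheses are merged here: independence inside each sequence is
  the inner assumption of \<open>indep_sets_UN\<close>, and \<open>indep_seq\<close> is the outer
  one, because each source lies in the sigma-algebra of its sequence.\<close>

lemma source_indep: "indep_sets source all_sources"
proof -
  define I where "I k = {k} \<times> (if k = 0 then {1::nat..} else {2..})" for k :: nat
  have lessThan_3: "{..<3} = {0, 1, 2::nat}" by auto
  have "indep_sets source (\<Union>k\<in>{..<3}. I k)"
  proof (rule indep_sets_UN)
    show "disjoint_family_on I {..<3}"
      by (auto simp: disjoint_family_on_def I_def)
    fix k :: nat assume k: "k \<in> {..<3}"
    have "indep_sets (\<lambda>j. source (k, j)) (if k = 0 then {1..} else {2..})"
      using X_indep eps_indep v_indep k by (auto simp: indep_vars_def2 source_def lessThan_3)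
    then have "indep_sets source (Pair k ` (if k = 0 then {1..} else {2..}))"
      by (intro indep_sets_reindex) (auto simp: inj_on_def)
    also have "Pair k ` (if k = 0 then {1..} else {2..}) = I k"
      by (auto simp: I_def)
    finally show "indep_sets source (I k)" .
  next
    show "indep_sets (\<lambda>k. sigma_sets (space M) (\<Union>i\<in>I k. source i)) {..<3}"
    proof (rule indep_sets_mono_sets[OF indep_seq])
      fix k :: nat assume k: "k \<in> {..<3}"
      let ?S = "[sequence_sigma M {1..} borel X, sequence_sigma M {2..} (count_space UNIV) \<epsilon>,
                sequence_sigma M {2..} (count_space UNIV) v] ! k"
      have "(\<Union>i\<in>I k. source i) \<subseteq> ?S"
        using k by (auto simp: lessThan_3 I_def source_def intro!: vimage_in_sequence_sigma)
      moreover have "sigma_algebra (space M) ?S"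
        using k by (auto simp: lessThan_3 sequence_sigma_def) (metis sets.sigma_algebra_axioms space_vimage_algebra)+
      ultimately show "sigma_sets (space M) (\<Union>i\<in>I k. source i) \<subseteq> ?S"
        using sigma_algebra.sigma_sets_subset by blast
    qed
  qed simp
  also have "(\<Union>k\<in>{..<3}. I k) = all_sources"
    by (auto simp: lessThan_3 I_def)
  finally show ?thesis .
qed

lemma space_info [simp]: "space (info K) = space M"
  by (simp add: info_def space_measure_of_conv)

lemma sets_info: "sets (info K) = sigma_sets (space M) (\<Union>i\<in>K. source i)"
  unfolding info_def by (rule sets_measure_of) (auto simp: source_def split: if_splits)

lemma sets_info_mono: "K \<subseteq> L \<Longrightarrow> sets (info K) \<subseteq> sets (info L)"
  unfolding sets_info by (rule sigma_sets_mono') auto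

lemma sets_info_events: "K \<subseteq> all_sources \<Longrightarrow> sets (info K) \<subseteq> events"
  unfolding sets_info using source_indep by (intro sets.sigma_sets_subset) (auto simp: indep_sets_def)

lemma measurable_info_mono:
  "f \<in> measurable (info K) N \<Longrightarrow> K \<subseteq> L \<Longrightarrow> f \<in> measurable (info L) N"
  using sets_info_mono[of K L] by (auto simp: measurable_def)

lemma measurable_info_imp:
  "f \<in> measurable (info K) N \<Longrightarrow> K \<subseteq> all_sources \<Longrightarrow> f \<in> measurable M N"
  using sets_info_events[of K] by (auto simp: measurable_def)

lemma source_in_info: "A \<in> source i \<Longrightarrow> i \<in> K \<Longrightarrow> A \<in> sets (info K)"
  unfolding sets_info by auto

lemma measurable_info:
  shows "(0, j) \<in> K \<Longrightarrow> X j \<in> borel_measurable (info K)"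
    and "(1, j) \<in> K \<Longrightarrow> \<epsilon> j \<in> measurable (info K) (count_space UNIV)"
    and "(2, j) \<in> K \<Longrightarrow> v j \<in> measurable (info K) (count_space UNIV)"
proof -
  show "X j \<in> borel_measurable (info K)" if "(0, j) \<in> K"
    by (rule measurableI) (auto intro!: source_in_info[OF _ that] exI simp: source_def)
  show "\<epsilon> j \<in> measurable (info K) (count_space UNIV)" if "(1, j) \<in> K"
    by (rule measurableI) (auto intro!: source_in_info[OF _ that] exI simp: source_def)
  show "v j \<in> measurable (info K) (count_space UNIV)" if "(2, j) \<in> K"
    by (rule measurableI) (auto intro!: source_in_info[OF _ that] exI simp: source_def)
qed

lemma expectation_mult_info:
  fixes f g :: "'a \<Rightarrow> real"
  assumes "K \<inter> L = {}" "K \<union> L \<subseteq> all_sources"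
    and "f \<in> borel_measurable (info K)" "integrable M f"
    and "g \<in> borel_measurable (info L)" "integrable M g"
  shows "integrable M (\<lambda>\<omega>. f \<omega> * g \<omega>)"
    and "expectation (\<lambda>\<omega>. f \<omega> * g \<omega>) = expectation f * expectation g"
  using expectation_mult_disjoint_sources[OF indep_sets_mono_index[OF assms(2) source_indep] assms(1) Int_stable_source]
    assms(3-) unfolding info_def by auto

section \<open>Walks with deterministic step values, as functions of the past\<close>

abbreviation past :: "nat \<Rightarrow> (nat \<times> nat) set" where
  "past n \<equiv> {1, 2} \<times> {2..n}"

text \<open>With the values frozen, steps depend on \<open>\<epsilon>\<close> and \<open>v\<close>
  alone and are therefore independent of \<open>X\<close>.\<close>

definition det_step :: "(nat \<Rightarrow> real) \<Rightarrow> nat \<Rightarrow> 'a \<Rightarrow> real" where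
  "det_step x k \<omega> = counterbalanced_step x (\<lambda>j. \<epsilon> j \<omega>) (\<lambda>j. v j \<omega>) k"

definition det_walk :: "(nat \<Rightarrow> real) \<Rightarrow> nat \<Rightarrow> 'a \<Rightarrow> real" where
  "det_walk x n \<omega> = (\<Sum>k=1..n. det_step x k \<omega>)"

abbreviation innovations :: "nat \<Rightarrow> 'a \<Rightarrow> nat" where
  "innovations n \<omega> \<equiv> innovation_count (\<lambda>j. \<epsilon> j \<omega>) n"

text \<open>Time 1 is included without a source of its own, as \<open>\<epsilon> 1\<close> is
  constant on the space; \<open>past n\<close> can therefore start at time 2.\<close>

lemma eps_measurable:
  assumes "1 \<le> j" "2 \<le> j \<Longrightarrow> (1, j) \<in> K"
  shows "\<epsilon> j \<in> measurable (info K) (count_space UNIV)"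
proof (cases "j = 1")
  case True
  have "(\<lambda>_. 1) \<in> measurable (info K) (count_space UNIV)" by simp
  then show ?thesis
    by (rule measurable_cong[THEN iffD1, rotated]) (use True eps_first in auto)
qed (use assms in \<open>auto intro: measurable_info\<close>)

lemma measurable_det_step:
  assumes "past n \<subseteq> K" "1 \<le> k" "k \<le> n"
  shows "det_step x k \<in> borel_measurable (info K)"
  unfolding det_step_def[abs_def]
  using assms by (intro measurable_step[where n = n] eps_measurable measurable_info) auto

lemma measurable_det_walk:
  assumes "past n \<subseteq> K"
  shows "det_walk x n \<in> borel_measurable (info K)"
  unfolding det_walk_def[abs_def]
  using assms by (intro borel_measurable_sum measurable_det_step) auto

lemma measurable_innovations:
  assumes "past n \<subseteq> K"
  shows "innovations n \<in> measurable (info K) (count_space UNIV)"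
  unfolding innovation_count_def using assms by (intro measurable_sum_nat eps_measurable) auto

lemma integrable_bounded:
  fixes f :: "'a \<Rightarrow> real"
  assumes "f \<in> borel_measurable (info K)" "K \<subseteq> all_sources" "\<And>\<omega>. \<bar>f \<omega>\<bar> \<le> B"
  shows "integrable M f"
  using measurable_info_imp[OF assms(1,2)] assms(3) by (intro integrable_const_bound[where B = B]) auto

lemma abs_det_step_le: "B \<ge> 0 \<Longrightarrow> (\<And>j. \<bar>x j\<bar> \<le> B) \<Longrightarrow> \<bar>det_step x k \<omega>\<bar> \<le> B"
  unfolding det_step_def by (rule abs_step_le)

lemma abs_det_walk_le: "B \<ge> 0 \<Longrightarrow> (\<And>j. \<bar>x j\<bar> \<le> B) \<Longrightarrow> \<bar>det_walk x n \<omega>\<bar> \<le> n * B"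
  unfolding det_walk_def
  by (rule order_trans[OF sum_abs], rule order_trans[OF sum_mono[where g = "\<lambda>_. B"]])
    (auto intro: abs_det_step_le)

section \<open>Mean of the next step given the past\<close>

lemma expectation_innovation:
  assumes "n \<ge> 2"
  shows "expectation (\<lambda>\<omega>. of_bool (\<epsilon> n \<omega> = 1)) = p"
    and "expectation (\<lambda>\<omega>. of_bool (\<epsilon> n \<omega> \<noteq> 1)) = 1 - p"
proof -
  have *: "expectation (\<lambda>\<omega>. f (\<epsilon> n \<omega>)) = p * f 1 + (1 - p) * f 0" for f :: "nat \<Rightarrow> real"
  proof -
    have "expectation (\<lambda>\<omega>. f (\<epsilon> n \<omega>)) = integral\<^sup>L (distr M (count_space UNIV) (\<epsilon> n)) f"
      using assms by (subst integral_distr) auto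
    also have "\<dots> = p * f 1 + (1 - p) * f 0"
      using p_range assms by (simp add: eps_law)
    finally show ?thesis .
  qed
  show "expectation (\<lambda>\<omega>. of_bool (\<epsilon> n \<omega> = 1)) = p"
    using *[of "\<lambda>i. of_bool (i = 1)"] by simp
  show "expectation (\<lambda>\<omega>. of_bool (\<epsilon> n \<omega> \<noteq> 1)) = 1 - p"
    using *[of "\<lambda>i. of_bool (i \<noteq> 1)"] by simp
qed

lemma expectation_choice:
  assumes "n \<ge> 1" "k \<in> {1..n}"
  shows "expectation (\<lambda>\<omega>. of_bool (v (Suc n) \<omega> = k)) = 1 / n"
proof -
  have "expectation (\<lambda>\<omega>. of_bool (v (Suc n) \<omega> = k)) =
      integral\<^sup>L (distr M (count_space UNIV) (v (Suc n))) (\<lambda>i. of_bool (i = k) :: real)"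
    using assms by (intro integral_distr[symmetric]) auto
  also have "\<dots> = 1 / n"
    using assms by (simp add: v_law integral_pmf_of_set)
  finally show ?thesis .
qed

text \<open>Laws determine values only up to null sets, so the decomposition of the walk into
  weights will hold almost surely, not pointwise.\<close>

lemma AE_eps_le_1: "AE \<omega> in M. \<forall>j\<ge>1. \<epsilon> j \<omega> \<le> 1"
proof -
  have "AE \<omega> in M. j \<ge> 1 \<longrightarrow> \<epsilon> j \<omega> \<le> 1" for j
  proof (cases "j \<ge> 2")
    case True
    have "AE i in distr M (count_space UNIV) (\<epsilon> j). i \<le> 1"
      unfolding eps_law[OF True] by (auto simp: AE_measure_pmf_iff)
    then have "AE \<omega> in M. \<epsilon> j \<omega> \<le> 1"
      using True by (subst (asm) AE_distr_iff) auto
    then show ?thesis by auto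
  next
    case False
    have "j \<ge> 1 \<longrightarrow> \<epsilon> j \<omega> \<le> 1" if "\<omega> \<in> space M" for \<omega>
      using False eps_first[OF that] by (cases "j = 1") auto
    then show ?thesis by auto
  qed
  then show ?thesis
    by (simp add: AE_all_countable)
qed

text \<open>The conditional mean of the next step, tested against a bounded function
  \<open>G\<close> of the past. The new innovation and the new choice are independent of the past
  and of each other, and averaging over a uniform choice among \<open>n\<close> earlier steps
  produces the walk divided by \<open>n\<close>.\<close>

lemma expectation_past_mult_step:
  assumes n: "n \<ge> 1" and G: "G \<in> borel_measurable (info (past n))" "\<And>\<omega>. \<bar>G \<omega>\<bar> \<le> C"
    and x: "B \<ge> 0" "\<And>j. \<bar>x j\<bar> \<le> B"
  shows "expectation (\<lambda>\<omega>. G \<omega> * det_step x (Suc n) \<omega>) =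
    p * expectation (\<lambda>\<omega>. G \<omega> * x (Suc (innovations n \<omega>))) -
    (1 - p) / n * expectation (\<lambda>\<omega>. G \<omega> * det_walk x n \<omega>)"
proof -
  have past: "past n \<subseteq> all_sources" by auto
  have eps_m: "(\<lambda>\<omega>. of_bool (P (\<epsilon> (Suc n) \<omega>)) :: real) \<in> borel_measurable (info {(1, Suc n)})" for P
    by (rule measurable_compose[OF measurable_info(2)]) auto
  have v_m: "(\<lambda>\<omega>. of_bool (v (Suc n) \<omega> = k) :: real) \<in> borel_measurable (info {(2, Suc n)})" for k
    by (rule measurable_compose[OF measurable_info(3)]) auto
  have eps_int: "integrable M (\<lambda>\<omega>. of_bool (P (\<epsilon> (Suc n) \<omega>)) :: real)" for P
    using n by (intro integrable_bounded[OF eps_m, where B = 1]) auto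
  have v_int: "integrable M (\<lambda>\<omega>. of_bool (v (Suc n) \<omega> = k) :: real)" for k
    using n by (intro integrable_bounded[OF v_m, where B = 1]) auto
  have factor_eps: "expectation (\<lambda>\<omega>. H \<omega> * of_bool (P (\<epsilon> (Suc n) \<omega>))) =
        expectation H * expectation (\<lambda>\<omega>. of_bool (P (\<epsilon> (Suc n) \<omega>)))"
      "integrable M (\<lambda>\<omega>. H \<omega> * of_bool (P (\<epsilon> (Suc n) \<omega>)))"
    if H: "H \<in> borel_measurable (info (past n))" "integrable M H" for H :: "'a \<Rightarrow> real" and P
    using n by (auto intro!: expectation_mult_info[OF _ _ H eps_m[of P] eps_int[of P]])
  have factor_v: "expectation (\<lambda>\<omega>. H \<omega> * of_bool (P (\<epsilon> (Suc n) \<omega>)) * of_bool (v (Suc n) \<omega> = k)) =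
        expectation H * expectation (\<lambda>\<omega>. of_bool (P (\<epsilon> (Suc n) \<omega>))) * expectation (\<lambda>\<omega>. of_bool (v (Suc n) \<omega> = k))"
      "integrable M (\<lambda>\<omega>. H \<omega> * of_bool (P (\<epsilon> (Suc n) \<omega>)) * of_bool (v (Suc n) \<omega> = k))"
    if H: "H \<in> borel_measurable (info (past n))" "integrable M H" for H :: "'a \<Rightarrow> real" and P k
  proof -
    \<comment> \<open>The two new sources are split off one at a time: the innovation is first
      joined to the past, and then the choice is separated from the enlarged group.\<close>
    have *: "(\<lambda>\<omega>. H \<omega> * of_bool (P (\<epsilon> (Suc n) \<omega>))) \<in> borel_measurable (info (insert (1, Suc n) (past n)))"
      by (intro borel_measurable_times measurable_info_mono[OF H(1)] measurable_info_mono[OF eps_m]) auto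
    note E = expectation_mult_info[OF _ _ * factor_eps(2)[OF H] v_m[of k] v_int[of k]]
    show "integrable M (\<lambda>\<omega>. H \<omega> * of_bool (P (\<epsilon> (Suc n) \<omega>)) * of_bool (v (Suc n) \<omega> = k))"
      using n by (intro E) auto
    show "expectation (\<lambda>\<omega>. H \<omega> * of_bool (P (\<epsilon> (Suc n) \<omega>)) * of_bool (v (Suc n) \<omega> = k)) =
        expectation H * expectation (\<lambda>\<omega>. of_bool (P (\<epsilon> (Suc n) \<omega>))) * expectation (\<lambda>\<omega>. of_bool (v (Suc n) \<omega> = k))"
      using n by (subst E(2)) (auto simp: factor_eps(1)[OF H])
  qed
  have GB: "\<bar>G \<omega> * y\<bar> \<le> C * B" if "\<bar>y\<bar> \<le> B" for \<omega> y
    unfolding abs_mult using that G(2)[of \<omega>] x(1) by (intro mult_mono) auto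
  have Gx_m: "(\<lambda>\<omega>. G \<omega> * x (Suc (innovations n \<omega>))) \<in> borel_measurable (info (past n))"
    by (intro borel_measurable_times G(1) measurable_compose[OF measurable_innovations]) auto
  have Gx: "integrable M (\<lambda>\<omega>. G \<omega> * x (Suc (innovations n \<omega>)))"
    by (rule integrable_bounded[OF Gx_m past GB[OF x(2)]])
  have Gs_m: "(\<lambda>\<omega>. G \<omega> * det_step x k \<omega>) \<in> borel_measurable (info (past n))" if "k \<in> {1..n}" for k
    using that by (intro borel_measurable_times G(1) measurable_det_step) auto
  have Gs: "integrable M (\<lambda>\<omega>. G \<omega> * det_step x k \<omega>)" if "k \<in> {1..n}" for k
    by (rule integrable_bounded[OF Gs_m[OF that] past GB[OF abs_det_step_le[OF x]]])
  have i1: "integrable M (\<lambda>\<omega>. G \<omega> * x (Suc (innovations n \<omega>)) * of_bool (\<epsilon> (Suc n) \<omega> = 1))"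
    by (rule factor_eps(2)[OF Gx_m Gx])
  have i2: "integrable M (\<lambda>\<omega>. G \<omega> * det_step x k \<omega> * of_bool (\<epsilon> (Suc n) \<omega> \<noteq> 1) * of_bool (v (Suc n) \<omega> = k))"
    if "k \<in> {1..n}" for k
    by (rule factor_v(2)[OF Gs_m[OF that] Gs[OF that]])
  have "expectation (\<lambda>\<omega>. G \<omega> * det_step x (Suc n) \<omega>) =
    expectation (\<lambda>\<omega>. G \<omega> * x (Suc (innovations n \<omega>)) * of_bool (\<epsilon> (Suc n) \<omega> = 1) -
      (\<Sum>k=1..n. G \<omega> * det_step x k \<omega> * of_bool (\<epsilon> (Suc n) \<omega> \<noteq> 1) * of_bool (v (Suc n) \<omega> = k)))"
    by (intro Bochner_Integration.integral_cong refl)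
      (simp only: det_step_def step_Suc right_diff_distrib sum_distrib_left mult_ac)
  also have "\<dots> = expectation (\<lambda>\<omega>. G \<omega> * x (Suc (innovations n \<omega>)) * of_bool (\<epsilon> (Suc n) \<omega> = 1)) -
      (\<Sum>k=1..n. expectation (\<lambda>\<omega>. G \<omega> * det_step x k \<omega> * of_bool (\<epsilon> (Suc n) \<omega> \<noteq> 1) * of_bool (v (Suc n) \<omega> = k)))"
    by (subst Bochner_Integration.integral_diff[OF i1 Bochner_Integration.integrable_sum[OF i2]], assumption,
        subst Bochner_Integration.integral_sum[OF i2]) auto
  also have "expectation (\<lambda>\<omega>. G \<omega> * x (Suc (innovations n \<omega>)) * of_bool (\<epsilon> (Suc n) \<omega> = 1)) =
      p * expectation (\<lambda>\<omega>. G \<omega> * x (Suc (innovations n \<omega>)))"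
    using n factor_eps(1)[OF Gx_m Gx, of "\<lambda>i. i = 1"] expectation_innovation(1)[of "Suc n"] by simp
  also have "(\<Sum>k=1..n. expectation (\<lambda>\<omega>. G \<omega> * det_step x k \<omega> * of_bool (\<epsilon> (Suc n) \<omega> \<noteq> 1) * of_bool (v (Suc n) \<omega> = k))) =
      (\<Sum>k=1..n. (1 - p) / n * expectation (\<lambda>\<omega>. G \<omega> * det_step x k \<omega>))"
  proof (rule sum.cong[OF refl])
    fix k assume k: "k \<in> {1..n}"
    show "expectation (\<lambda>\<omega>. G \<omega> * det_step x k \<omega> * of_bool (\<epsilon> (Suc n) \<omega> \<noteq> 1) * of_bool (v (Suc n) \<omega> = k)) =
        (1 - p) / n * expectation (\<lambda>\<omega>. G \<omega> * det_step x k \<omega>)"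
      using n factor_v(1)[OF Gs_m[OF k] Gs[OF k], of "\<lambda>i. i \<noteq> 1" k]
        expectation_innovation(2)[of "Suc n"] expectation_choice[OF n k] by simp
  qed
  also have "\<dots> = (1 - p) / n * expectation (\<lambda>\<omega>. G \<omega> * det_walk x n \<omega>)"
    unfolding det_walk_def sum_distrib_left[symmetric]
    by (subst Bochner_Integration.integral_sum[symmetric]) (use Gs in \<open>auto simp: sum_distrib_left\<close>)
  finally show ?thesis .
qed

section \<open>Second moments of the weights and of their total\<close>

lemma det_walk_Suc: "det_walk x (Suc n) \<omega> = det_walk x n \<omega> + det_step x (Suc n) \<omega>"
  by (simp add: det_walk_def)

lemma integrable_abs_sq:
  fixes f :: "'a \<Rightarrow> real"
  assumes "f \<in> borel_measurable (info K)" "K \<subseteq> all_sources" "\<And>\<omega>. \<bar>f \<omega>\<bar> \<le> B"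
  shows "integrable M (\<lambda>\<omega>. (f \<omega>)\<^sup>2)"
proof (rule integrable_bounded[where B = "B\<^sup>2"])
  show "(\<lambda>\<omega>. (f \<omega>)\<^sup>2) \<in> borel_measurable (info K)"
    using assms(1) by (rule borel_measurable_power)
  show "\<bar>(f \<omega>)\<^sup>2\<bar> \<le> B\<^sup>2" for \<omega>
    using power_mono[OF assms(3), of \<omega> 2] by simp
qed fact

text \<open>Write T for the centred walk. By \<open>next_x\<close> the innovation part of the mean
  of T times the next step is \<open>p * b\<close> times the mean of T, and the copying part leaves
  -(1 - p)/n times the mean of T squared. Increments thus have nonpositive correlation with T, and
  expanding the square inductively leaves only their own second moments.\<close>

lemma second_moment_det_walk_le:
  assumes a: "a = b * (p / (2 - p))" and x: "\<And>j. \<bar>x j\<bar> \<le> 1"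
    and next_x: "\<And>n \<omega>. (det_walk x n \<omega> - a * n) * x (Suc (innovations n \<omega>)) = b * (det_walk x n \<omega> - a * n)"
  shows "expectation (\<lambda>\<omega>. (det_walk x n \<omega> - a * n)\<^sup>2) \<le> (\<Sum>k=1..n. expectation (\<lambda>\<omega>. (det_step x k \<omega> - a)\<^sup>2))"
proof (induction n)
  case 0
  then show ?case by (simp add: det_walk_def)
next
  case (Suc n)
  define T where "T \<omega> = det_walk x n \<omega> - a * n" for \<omega>
  have T_m: "T \<in> borel_measurable (info (past n))"
    unfolding T_def[abs_def] by (intro borel_measurable_diff measurable_det_walk) auto
  have T_b: "\<bar>T \<omega>\<bar> \<le> n + \<bar>a\<bar> * n" for \<omega>
    using abs_det_walk_le[of 1 x n \<omega>] x abs_triangle_ineq4[of "det_walk x n \<omega>" "a * n"]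
    by (simp add: T_def abs_mult)
  have s_m: "(\<lambda>\<omega>. det_step x (Suc n) \<omega> - a) \<in> borel_measurable (info (past (Suc n)))"
    by (intro borel_measurable_diff measurable_det_step[where n = "Suc n"]) auto
  have s_b: "\<bar>det_step x (Suc n) \<omega> - a\<bar> \<le> 1 + \<bar>a\<bar>" for \<omega>
    using abs_det_step_le[of 1 x "Suc n" \<omega>] x abs_triangle_ineq4[of "det_step x (Suc n) \<omega>" a] by simp
  have past: "past n \<subseteq> all_sources" "past (Suc n) \<subseteq> all_sources" "past n \<subseteq> past (Suc n)" by auto
  have T_int: "integrable M T" "integrable M (\<lambda>\<omega>. (T \<omega>)\<^sup>2)"
    by (rule integrable_bounded[OF T_m past(1) T_b] integrable_abs_sq[OF T_m past(1) T_b])+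
  have s_int: "integrable M (\<lambda>\<omega>. (det_step x (Suc n) \<omega> - a)\<^sup>2)"
    by (rule integrable_abs_sq[OF s_m past(2) s_b])
  have prod_m: "(\<lambda>\<omega>. T \<omega> * (det_step x (Suc n) \<omega> - a)) \<in> borel_measurable (info (past (Suc n)))"
    by (intro borel_measurable_times s_m measurable_info_mono[OF T_m past(3)])
  have prod_int: "integrable M (\<lambda>\<omega>. T \<omega> * (det_step x (Suc n) \<omega> - a))"
    by (rule integrable_bounded[OF prod_m past(2), where B = "(n + \<bar>a\<bar> * n) * (1 + \<bar>a\<bar>)"])
      (auto simp: abs_mult intro!: mult_mono T_b s_b)
  have cross: "expectation (\<lambda>\<omega>. T \<omega> * (det_step x (Suc n) \<omega> - a)) \<le> 0"
  proof (cases "n = 0")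
    \<comment> \<open>The first step is always an innovation, so the one-step formula does not cover
      it; the cross term vanishes anyway because the walk starts at 0.\<close>
    case True
    then show ?thesis by (simp add: T_def det_walk_def)
  next
    case False
    have Ts_int: "integrable M (\<lambda>\<omega>. T \<omega> * det_step x (Suc n) \<omega>)"
      using Bochner_Integration.integrable_add[OF prod_int integrable_mult_left[OF T_int(1), of a]]
      by (simp add: algebra_simps)
    have "expectation (\<lambda>\<omega>. T \<omega> * (det_step x (Suc n) \<omega> - a)) =
        expectation (\<lambda>\<omega>. T \<omega> * det_step x (Suc n) \<omega>) - a * expectation T"
      using Ts_int T_int(1) by (simp add: right_diff_distrib)
    also have "expectation (\<lambda>\<omega>. T \<omega> * det_step x (Suc n) \<omega>) =
        p * expectation (\<lambda>\<omega>. b * T \<omega>) - (1 - p) / n * expectation (\<lambda>\<omega>. T \<omega> * det_walk x n \<omega>)"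
      using False x next_x[of n]
      by (subst expectation_past_mult_step[OF _ T_m T_b, where B = 1]) (auto simp only: T_def)
    also have "expectation (\<lambda>\<omega>. T \<omega> * det_walk x n \<omega>) = expectation (\<lambda>\<omega>. (T \<omega>)\<^sup>2 + a * n * T \<omega>)"
      by (rule Bochner_Integration.integral_cong) (simp_all add: T_def power2_eq_square algebra_simps)
    also have "\<dots> = expectation (\<lambda>\<omega>. (T \<omega>)\<^sup>2) + a * n * expectation T"
      using T_int by simp
    also have "p * expectation (\<lambda>\<omega>. b * T \<omega>) -
          (1 - p) / n * (expectation (\<lambda>\<omega>. (T \<omega>)\<^sup>2) + a * n * expectation T) - a * expectation T =
        (p * b - (2 - p) * a) * expectation T - (1 - p) / n * expectation (\<lambda>\<omega>. (T \<omega>)\<^sup>2)"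
      using False by (simp add: field_simps)
    \<comment> \<open>The value of \<open>a\<close> is the root of p b - (1 - p) a = a. It removes
      the term linear in \<open>T\<close>, whose mean need not vanish.\<close>
    also have "p * b - (2 - p) * a = 0"
      using p_range by (simp add: a)
    also have "0 * expectation T - (1 - p) / n * expectation (\<lambda>\<omega>. (T \<omega>)\<^sup>2) \<le> 0"
      using p_range by simp
    finally show ?thesis .
  qed
  have "expectation (\<lambda>\<omega>. (det_walk x (Suc n) \<omega> - a * Suc n)\<^sup>2) =
      expectation (\<lambda>\<omega>. (T \<omega>)\<^sup>2 + 2 * (T \<omega> * (det_step x (Suc n) \<omega> - a)) + (det_step x (Suc n) \<omega> - a)\<^sup>2)"
    by (rule Bochner_Integration.integral_cong)
      (simp_all add: det_walk_Suc T_def power2_eq_square algebra_simps)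
  also have "\<dots> = expectation (\<lambda>\<omega>. (T \<omega>)\<^sup>2) + 2 * expectation (\<lambda>\<omega>. T \<omega> * (det_step x (Suc n) \<omega> - a))
      + expectation (\<lambda>\<omega>. (det_step x (Suc n) \<omega> - a)\<^sup>2)"
    using T_int(2) prod_int s_int by simp
  also have "\<dots> \<le> (\<Sum>k=1..Suc n. expectation (\<lambda>\<omega>. (det_step x k \<omega> - a)\<^sup>2))"
    using Suc cross by (simp add: T_def)
  finally show ?case .
qed

abbreviation weight :: "nat \<Rightarrow> nat \<Rightarrow> 'a \<Rightarrow> real" where
  "weight j n \<omega> \<equiv> det_walk (unit_seq j) n \<omega>"

text \<open>After the bound with a = b = 0 for each label, exchanging the sums leaves, for each
  step, the sum of squares over labels, which is at most 1 because a step has at most one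
  origin.\<close>

lemma weight_square_sum_le: "(\<Sum>j=1..n. expectation (\<lambda>\<omega>. (weight j n \<omega>)\<^sup>2)) \<le> n"
proof -
  have int: "integrable M (\<lambda>\<omega>. (det_step (unit_seq j) k \<omega>)\<^sup>2)" if "k \<in> {1..n}" for j k
    using that by (intro integrable_abs_sq[OF measurable_det_step[where K = "past n" and n = n], where B = 1]
        abs_det_step_le) auto
  have le: "expectation (\<lambda>\<omega>. (weight j n \<omega>)\<^sup>2) \<le> (\<Sum>k=1..n. expectation (\<lambda>\<omega>. (det_step (unit_seq j) k \<omega>)\<^sup>2))" for j
  proof -
    \<comment> \<open>This is \<open>next_x\<close> with b = 0: if the next innovation is to receive
      label \<open>j\<close>, no step so far can descend from that label.\<close>
    have "weight j n \<omega> * of_bool (Suc (innovations n \<omega>) = j) = 0" for n \<omega>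
    proof (cases "Suc (innovations n \<omega>) = j")
      case True
      have "innovation_count (\<lambda>j. \<epsilon> j \<omega>) k < j" if "k \<in> {1..n}" for k
        using innovation_count_mono[of k n "\<lambda>j. \<epsilon> j \<omega>"] that True by auto
      then have "weight j n \<omega> = 0"
        unfolding det_walk_def det_step_def by (intro sum.neutral) (auto intro: step_unit_seq_eq_0)
      then show ?thesis by simp
    qed simp
    then show ?thesis
      using second_moment_det_walk_le[of 0 0 "unit_seq j" n] by simp
  qed
  have "(\<Sum>j=1..n. expectation (\<lambda>\<omega>. (weight j n \<omega>)\<^sup>2)) \<le>
      (\<Sum>j=1..n. \<Sum>k=1..n. expectation (\<lambda>\<omega>. (det_step (unit_seq j) k \<omega>)\<^sup>2))"
    by (rule sum_mono[OF le])
  also have "\<dots> = (\<Sum>k=1..n. expectation (\<lambda>\<omega>. \<Sum>j=1..n. (det_step (unit_seq j) k \<omega>)\<^sup>2))"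
    by (subst sum.swap) (auto intro!: sum.cong simp: int)
  also have "\<dots> \<le> (\<Sum>k=1..n. 1)"
  proof (rule sum_mono)
    fix k assume k: "k \<in> {1..n}"
    have "(\<Sum>j=1..n. (det_step (unit_seq j) k \<omega>)\<^sup>2) \<le> 1" for \<omega>
    proof -
      \<comment> \<open>Values in [-1, 1] have squares below their absolute values, which reduces
        the claim to the pathwise count of origins.\<close>
      have "(det_step (unit_seq j) k \<omega>)\<^sup>2 \<le> \<bar>det_step (unit_seq j) k \<omega>\<bar>" for j
        using abs_det_step_le[of 1 "unit_seq j" k \<omega>] mult_left_le[of "\<bar>det_step (unit_seq j) k \<omega>\<bar>" "\<bar>det_step (unit_seq j) k \<omega>\<bar>"]
        by (simp add: power2_eq_square)
      then have "(\<Sum>j=1..n. (det_step (unit_seq j) k \<omega>)\<^sup>2) \<le> (\<Sum>j=1..n. \<bar>det_step (unit_seq j) k \<omega>\<bar>)"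
        by (rule sum_mono)
      also have "\<dots> \<le> 1"
        unfolding det_step_def by (rule sum_abs_step_unit_seq_le) simp
      finally show ?thesis .
    qed
    then show "expectation (\<lambda>\<omega>. \<Sum>j=1..n. (det_step (unit_seq j) k \<omega>)\<^sup>2) \<le> 1"
      using int[OF k] by (intro integral_le_const) auto
  qed
  finally show ?thesis by simp
qed

lemma sum_abs_weight_le: "(\<Sum>j=1..n. \<bar>weight j n \<omega>\<bar>) \<le> n"
proof -
  have "(\<Sum>j=1..n. \<bar>weight j n \<omega>\<bar>) \<le> (\<Sum>j=1..n. \<Sum>k=1..n. \<bar>det_step (unit_seq j) k \<omega>\<bar>)"
    unfolding det_walk_def by (intro sum_mono sum_abs)
  also have "\<dots> = (\<Sum>k=1..n. \<Sum>j=1..n. \<bar>det_step (unit_seq j) k \<omega>\<bar>)"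
    by (rule sum.swap)
  also have "\<dots> \<le> (\<Sum>k=1..n. 1)"
    unfolding det_step_def by (intro sum_mono sum_abs_step_unit_seq_le) simp
  finally show ?thesis by simp
qed

text \<open>All innovations have value 1, so b = 1 and \<open>a\<close> becomes p/(2 - p). The
  constant is 2 squared: steps lie in [-1, 1] and p/(2 - p) in [0, 1].\<close>

lemma second_moment_unit_walk_le:
  "expectation (\<lambda>\<omega>. (det_walk (\<lambda>_. 1) n \<omega> - p / (2 - p) * n)\<^sup>2) \<le> 4 * n"
proof -
  let ?c = "p / (2 - p)"
  have c: "0 \<le> ?c" "?c \<le> 1"
    using p_range by auto
  have "expectation (\<lambda>\<omega>. (det_walk (\<lambda>_. 1) n \<omega> - ?c * n)\<^sup>2) \<le> (\<Sum>k=1..n. expectation (\<lambda>\<omega>. (det_step (\<lambda>_. 1) k \<omega> - ?c)\<^sup>2))"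
    by (rule second_moment_det_walk_le[where b = 1]) auto
  also have "\<dots> \<le> (\<Sum>k=1..n. 4)"
  proof (rule sum_mono)
    fix k assume k: "k \<in> {1..n}"
    have b: "\<bar>det_step (\<lambda>_. 1) k \<omega> - ?c\<bar> \<le> 2" for \<omega>
      using abs_det_step_le[of 1 "\<lambda>_. 1" k \<omega>] c by auto
    have m: "(\<lambda>\<omega>. det_step (\<lambda>_. 1) k \<omega> - ?c) \<in> borel_measurable (info (past n))"
      using k by (intro borel_measurable_diff measurable_det_step[where n = n]) auto
    have "(det_step (\<lambda>_. 1) k \<omega> - ?c)\<^sup>2 \<le> 4" for \<omega>
      using power_mono[OF b, of \<omega> 2] by simp
    then show "expectation (\<lambda>\<omega>. (det_step (\<lambda>_. 1) k \<omega> - ?c)\<^sup>2) \<le> 4"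
      by (intro integral_le_const integrable_abs_sq[OF m _ b]) auto
  qed
  finally show ?thesis by simp
qed

text \<open>The exceptional null set comes from \<open>\<epsilon>\<close> alone. Quantifying over
  \<open>x\<close> inside the almost sure statement is essential: \<open>x\<close> is later replaced
  by the realised values of \<open>X\<close>, which vary with the sample point.\<close>

lemma AE_walk_eq_sum:
  "AE \<omega> in M. \<forall>n x. det_walk x n \<omega> = (\<Sum>j=1..n. x j * weight j n \<omega>)"
  using AE_eps_le_1
proof (rule AE_mp, intro AE_I2 impI allI)
  fix \<omega> n x assume e: "\<forall>j\<ge>1. \<epsilon> j \<omega> \<le> 1"
  have "det_walk x n \<omega> = (\<Sum>k=1..n. \<Sum>j=1..n. x j * det_step (unit_seq j) k \<omega>)"
    unfolding det_walk_def det_step_def using e by (intro sum.cong refl step_eq_sum_unit_seq) auto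
  also have "\<dots> = (\<Sum>j=1..n. x j * weight j n \<omega>)"
    unfolding det_walk_def sum_distrib_left by (rule sum.swap)
  finally show "det_walk x n \<omega> = (\<Sum>j=1..n. x j * weight j n \<omega>)" .
qed

section \<open>Random values: weighted sums of functions of the innovations\<close>

abbreviation weighted_sum :: "(real \<Rightarrow> real) \<Rightarrow> nat \<Rightarrow> 'a \<Rightarrow> real" where
  "weighted_sum f n \<omega> \<equiv> (\<Sum>j=1..n. f (X j \<omega>) * weight j n \<omega>)"

lemma AE_counterbalanced_walk_eq:
  "AE \<omega> in M. \<forall>n. counterbalanced_walk X \<epsilon> v n \<omega> = weighted_sum (\<lambda>y. y) n \<omega>"
  using AE_walk_eq_sum
proof (rule AE_mp, intro AE_I2 impI allI)
  fix \<omega> n assume *: "\<forall>n x. det_walk x n \<omega> = (\<Sum>j=1..n. x j * weight j n \<omega>)"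
  have "counterbalanced_walk X \<epsilon> v n \<omega> = det_walk (\<lambda>j. X j \<omega>) n \<omega>"
    by (simp only: counterbalanced_walk_def det_step_def det_walk_def)
  then show "counterbalanced_walk X \<epsilon> v n \<omega> = (\<Sum>j=1..n. X j \<omega> * weight j n \<omega>)"
    using *[rule_format, of "\<lambda>j. X j \<omega>" n] by simp
qed

lemma counterbalanced_walk_measurable: "counterbalanced_walk X \<epsilon> v n \<in> borel_measurable M"
proof -
  have e: "\<epsilon> j \<in> measurable M (count_space UNIV)" if "1 \<le> j" for j
  proof (cases "j = 1")
    case True
    have "(\<lambda>_. 1) \<in> measurable M (count_space UNIV)" by simp
    then show ?thesis
      by (rule measurable_cong[THEN iffD1, rotated]) (use True eps_first in auto)
  qed (use that measurable_sequences in auto)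
  show ?thesis
    unfolding counterbalanced_walk_def[abs_def]
    by (intro borel_measurable_sum measurable_step[where n = n] measurable_sequences e) auto
qed

lemma identically_distributed:
  fixes f :: "real \<Rightarrow> real"
  assumes f: "f \<in> borel_measurable borel" and "j \<ge> 1"
  shows "integrable M (\<lambda>\<omega>. f (X j \<omega>)) \<longleftrightarrow> integrable M (\<lambda>\<omega>. f (X 1 \<omega>))"
    and "expectation (\<lambda>\<omega>. f (X j \<omega>)) = expectation (\<lambda>\<omega>. f (X 1 \<omega>))"
proof -
  have eq: "distr M borel (X j) = distr M borel (X 1)"
    using X_law assms by simp
  show "integrable M (\<lambda>\<omega>. f (X j \<omega>)) \<longleftrightarrow> integrable M (\<lambda>\<omega>. f (X 1 \<omega>))"
    using integrable_distr_eq[of "X j" M borel f] integrable_distr_eq[of "X 1" M borel f] assms eq by simp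
  show "expectation (\<lambda>\<omega>. f (X j \<omega>)) = expectation (\<lambda>\<omega>. f (X 1 \<omega>))"
    using integral_distr[of "X j" M borel f] integral_distr[of "X 1" M borel f] assms eq by simp
qed

lemma measurable_weight: "weight j n \<in> borel_measurable (info ({1, 2} \<times> {2..}))"
  by (rule measurable_det_walk) auto

lemma abs_weight_le: "\<bar>weight j n \<omega>\<bar> \<le> n"
  using abs_det_walk_le[of 1 "unit_seq j" n \<omega>] by simp

lemma integrable_weight: "integrable M (weight j n)"
  by (rule integrable_bounded[OF measurable_weight _ abs_weight_le]) auto

lemma measurable_X_info: "j \<ge> 1 \<Longrightarrow> X j \<in> borel_measurable (info ({0} \<times> {1..}))"
  by (rule measurable_info) auto

lemma expectation_X_mult_weights:
  fixes f g :: "'a \<Rightarrow> real"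
  assumes "f \<in> borel_measurable (info ({0} \<times> {1..}))" "integrable M f"
    and "g \<in> borel_measurable (info ({1, 2} \<times> {2..}))" "integrable M g"
  shows "integrable M (\<lambda>\<omega>. f \<omega> * g \<omega>)"
    and "expectation (\<lambda>\<omega>. f \<omega> * g \<omega>) = expectation f * expectation g"
  by (rule expectation_mult_info[OF _ _ assms]; auto)+

text \<open>Values and weights are independent, so the mean absolute value of \<open>f\<close>
  factors out of each term, and the absolute weights sum to at most \<open>n\<close> on every path.
  Applied to the tail it bounds the truncation error; applied to the identity it gives integrability
  of the walk.\<close>

lemma weighted_sum_L1:
  assumes f: "f \<in> borel_measurable borel" "integrable M (\<lambda>\<omega>. f (X 1 \<omega>))"
  shows "integrable M (weighted_sum f n)"
    and "expectation (\<lambda>\<omega>. \<bar>weighted_sum f n \<omega>\<bar>) \<le> n * expectation (\<lambda>\<omega>. \<bar>f (X 1 \<omega>)\<bar>)"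
proof -
  have fX: "(\<lambda>\<omega>. f (X j \<omega>)) \<in> borel_measurable (info ({0} \<times> {1..}))" "integrable M (\<lambda>\<omega>. f (X j \<omega>))"
    if "j \<in> {1..n}" for j
  proof -
    have "j \<ge> 1" using that by simp
    then show "(\<lambda>\<omega>. f (X j \<omega>)) \<in> borel_measurable (info ({0} \<times> {1..}))" "integrable M (\<lambda>\<omega>. f (X j \<omega>))"
      using measurable_compose[OF measurable_X_info f(1)] identically_distributed(1)[OF f(1)] f(2) by blast+
  qed
  have int: "integrable M (\<lambda>\<omega>. f (X j \<omega>) * weight j n \<omega>)" if "j \<in> {1..n}" for j
    by (rule expectation_X_mult_weights[OF fX[OF that] measurable_weight integrable_weight])
  then show S: "integrable M (weighted_sum f n)"
    by (rule Bochner_Integration.integrable_sum)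
  have abs_f: "(\<lambda>y. \<bar>f y\<bar>) \<in> borel_measurable borel"
    using f(1) by simp
  have "expectation (\<lambda>\<omega>. \<bar>weighted_sum f n \<omega>\<bar>) \<le> expectation (\<lambda>\<omega>. \<Sum>j=1..n. \<bar>f (X j \<omega>)\<bar> * \<bar>weight j n \<omega>\<bar>)"
  proof (rule integral_mono)
    show "integrable M (\<lambda>\<omega>. \<Sum>j=1..n. \<bar>f (X j \<omega>)\<bar> * \<bar>weight j n \<omega>\<bar>)"
      unfolding abs_mult[symmetric] using int by (intro Bochner_Integration.integrable_sum integrable_abs)
    show "\<bar>weighted_sum f n \<omega>\<bar> \<le> (\<Sum>j=1..n. \<bar>f (X j \<omega>)\<bar> * \<bar>weight j n \<omega>\<bar>)" for \<omega>
      unfolding abs_mult[symmetric] by (rule sum_abs)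
  qed (use S in auto)
  also have "\<dots> = (\<Sum>j=1..n. expectation (\<lambda>\<omega>. \<bar>f (X j \<omega>)\<bar> * \<bar>weight j n \<omega>\<bar>))"
    unfolding abs_mult[symmetric] using int by (intro Bochner_Integration.integral_sum integrable_abs)
  also have "\<dots> = (\<Sum>j=1..n. expectation (\<lambda>\<omega>. \<bar>f (X 1 \<omega>)\<bar>) * expectation (\<lambda>\<omega>. \<bar>weight j n \<omega>\<bar>))"
  proof (rule sum.cong[OF refl])
    fix j assume j: "j \<in> {1..n}"
    have "expectation (\<lambda>\<omega>. \<bar>f (X j \<omega>)\<bar> * \<bar>weight j n \<omega>\<bar>) =
        expectation (\<lambda>\<omega>. \<bar>f (X j \<omega>)\<bar>) * expectation (\<lambda>\<omega>. \<bar>weight j n \<omega>\<bar>)"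
      using fX[OF j] measurable_weight integrable_weight
      by (intro expectation_X_mult_weights borel_measurable_abs integrable_abs)
    then show "expectation (\<lambda>\<omega>. \<bar>f (X j \<omega>)\<bar> * \<bar>weight j n \<omega>\<bar>) =
        expectation (\<lambda>\<omega>. \<bar>f (X 1 \<omega>)\<bar>) * expectation (\<lambda>\<omega>. \<bar>weight j n \<omega>\<bar>)"
      using identically_distributed(2)[OF abs_f, of j] j by simp
  qed
  also have "\<dots> = expectation (\<lambda>\<omega>. \<bar>f (X 1 \<omega>)\<bar>) * expectation (\<lambda>\<omega>. \<Sum>j=1..n. \<bar>weight j n \<omega>\<bar>)"
    by (subst Bochner_Integration.integral_sum) (auto simp: sum_distrib_left intro: integrable_weight)
  also have "\<dots> \<le> expectation (\<lambda>\<omega>. \<bar>f (X 1 \<omega>)\<bar>) * n"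
    by (intro mult_left_mono integral_le_const AE_I2 sum_abs_weight_le)
      (auto intro!: Bochner_Integration.integrable_sum integrable_abs integrable_weight)
  finally show "expectation (\<lambda>\<omega>. \<bar>weighted_sum f n \<omega>\<bar>) \<le> n * expectation (\<lambda>\<omega>. \<bar>f (X 1 \<omega>)\<bar>)"
    by (simp add: mult.commute)
qed

lemma integrable_X_bounded:
  fixes f :: "real \<Rightarrow> real"
  assumes "f \<in> borel_measurable borel" "\<And>y. \<bar>f y\<bar> \<le> B" "j \<ge> 1"
  shows "integrable M (\<lambda>\<omega>. f (X j \<omega>))"
  using assms measurable_sequences by (intro integrable_const_bound[where B = B]) auto

text \<open>The weights may be dependent, but each mixed term carries the mean of a product of two
  independent centred variables and vanishes. On the diagonal only the sum of the squared weights
  remains.\<close>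

lemma second_moment_weighted_sum_le:
  assumes f: "f \<in> borel_measurable borel" "\<And>y. \<bar>f y\<bar> \<le> B"
    and centered: "expectation (\<lambda>\<omega>. f (X 1 \<omega>)) = 0"
  shows "integrable M (\<lambda>\<omega>. (weighted_sum f n \<omega>)\<^sup>2)"
    and "expectation (\<lambda>\<omega>. (weighted_sum f n \<omega>)\<^sup>2) \<le> B\<^sup>2 * n"
proof -
  have B: "B \<ge> 0"
    using f(2)[of 0] by linarith
  have ff_m: "(\<lambda>\<omega>. f (X i \<omega>) * f (X j \<omega>)) \<in> borel_measurable (info ({0} \<times> {1..}))"
    if "i \<in> {1..n}" "j \<in> {1..n}" for i j
    using that f(1) by (intro borel_measurable_times measurable_compose[OF measurable_X_info]) auto
  have ff_b: "\<bar>f y * f z\<bar> \<le> B\<^sup>2" for y z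
    unfolding abs_mult power2_eq_square using B by (intro mult_mono f) auto
  have ff_int: "integrable M (\<lambda>\<omega>. f (X i \<omega>) * f (X j \<omega>))"
    if "i \<in> {1..n}" "j \<in> {1..n}" for i j
    by (rule integrable_bounded[OF ff_m[OF that] _ ff_b]) auto
  have ww_m: "(\<lambda>\<omega>. weight i n \<omega> * weight j n \<omega>) \<in> borel_measurable (info ({1, 2} \<times> {2..}))" for i j
    by (intro borel_measurable_times measurable_weight)
  have ww_int: "integrable M (\<lambda>\<omega>. weight i n \<omega> * weight j n \<omega>)" for i j
    by (rule integrable_bounded[OF ww_m, where B = "real n * n"])
      (auto simp: abs_mult intro!: mult_mono abs_weight_le)
  have sq: "(weighted_sum f n \<omega>)\<^sup>2 =
      (\<Sum>i=1..n. \<Sum>j=1..n. (f (X i \<omega>) * f (X j \<omega>)) * (weight i n \<omega> * weight j n \<omega>))" for \<omega>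
    by (simp add: power2_eq_square sum_product mult_ac)
  have int: "integrable M (\<lambda>\<omega>. (f (X i \<omega>) * f (X j \<omega>)) * (weight i n \<omega> * weight j n \<omega>))"
    if "i \<in> {1..n}" "j \<in> {1..n}" for i j
    by (rule expectation_X_mult_weights[OF ff_m[OF that] ff_int[OF that] ww_m ww_int])
  show "integrable M (\<lambda>\<omega>. (weighted_sum f n \<omega>)\<^sup>2)"
    unfolding sq using int by (intro Bochner_Integration.integrable_sum)
  have uncorrelated: "expectation (\<lambda>\<omega>. f (X i \<omega>) * f (X j \<omega>)) = 0"
    if "i \<in> {1..n}" "j \<in> {1..n}" "i \<noteq> j" for i j
  proof -
    have "expectation (\<lambda>\<omega>. f (X i \<omega>) * f (X j \<omega>)) =
        expectation (\<lambda>\<omega>. f (X i \<omega>)) * expectation (\<lambda>\<omega>. f (X j \<omega>))"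
      using that f(1)
      by (intro expectation_mult_info[where K = "{(0, i)}" and L = "{(0, j)}"]
          measurable_compose[OF measurable_info(1)] integrable_X_bounded[OF f]) auto
    then show ?thesis
      using identically_distributed(2)[OF f(1), of i] that centered by simp
  qed
  have "expectation (\<lambda>\<omega>. (weighted_sum f n \<omega>)\<^sup>2) =
      (\<Sum>i=1..n. \<Sum>j=1..n. expectation (\<lambda>\<omega>. (f (X i \<omega>) * f (X j \<omega>)) * (weight i n \<omega> * weight j n \<omega>)))"
    unfolding sq
    by (subst Bochner_Integration.integral_sum, (intro Bochner_Integration.integrable_sum int; assumption))
      (intro sum.cong refl Bochner_Integration.integral_sum int)
  also have "\<dots> = (\<Sum>i=1..n. \<Sum>j=1..n.
      if i = j then expectation (\<lambda>\<omega>. f (X i \<omega>) * f (X i \<omega>)) * expectation (\<lambda>\<omega>. (weight i n \<omega>)\<^sup>2) else 0)"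
    by (intro sum.cong refl)
      (simp add: expectation_X_mult_weights(2)[OF ff_m ff_int ww_m ww_int] uncorrelated power2_eq_square)
  also have "\<dots> = (\<Sum>i=1..n. expectation (\<lambda>\<omega>. f (X i \<omega>) * f (X i \<omega>)) * expectation (\<lambda>\<omega>. (weight i n \<omega>)\<^sup>2))"
    by simp
  also have "\<dots> \<le> (\<Sum>i=1..n. B\<^sup>2 * expectation (\<lambda>\<omega>. (weight i n \<omega>)\<^sup>2))"
  proof (intro sum_mono mult_right_mono)
    fix i assume "i \<in> {1..n}"
    then show "expectation (\<lambda>\<omega>. f (X i \<omega>) * f (X i \<omega>)) \<le> B\<^sup>2"
      using ff_b by (intro integral_le_const ff_int AE_I2) (auto intro: order_trans[OF abs_ge_self])
  qed simp
  also have "\<dots> \<le> B\<^sup>2 * n"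
    unfolding sum_distrib_left[symmetric] by (intro mult_left_mono weight_square_sum_le) auto
  finally show "expectation (\<lambda>\<omega>. (weighted_sum f n \<omega>)\<^sup>2) \<le> B\<^sup>2 * n" .
qed

section \<open>From second moments to convergence in L1\<close>

lemma expectation_abs_le_sqrt:
  fixes Y :: "'a \<Rightarrow> real"
  assumes "integrable M Y" "integrable M (\<lambda>\<omega>. (Y \<omega>)\<^sup>2)" "expectation (\<lambda>\<omega>. (Y \<omega>)\<^sup>2) \<le> C"
  shows "expectation (\<lambda>\<omega>. \<bar>Y \<omega>\<bar>) \<le> sqrt C"
proof (rule real_le_rsqrt)
  have "0 \<le> variance (\<lambda>\<omega>. \<bar>Y \<omega>\<bar>)"
    by (rule variance_positive)
  also have "\<dots> = expectation (\<lambda>\<omega>. (Y \<omega>)\<^sup>2) - (expectation (\<lambda>\<omega>. \<bar>Y \<omega>\<bar>))\<^sup>2"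
    using assms(1,2) by (subst variance_eq) auto
  finally show "(expectation (\<lambda>\<omega>. \<bar>Y \<omega>\<bar>))\<^sup>2 \<le> C"
    using assms(3) by simp
qed

text \<open>Centring \<open>f\<close> splits the error into fluctuations of the values and
  \<open>m\<close> times the fluctuation of the total weight. The centred function is bounded by 2B
  and contributes 2B sqrt n; the other part contributes at most B sqrt(4n), which is 2B sqrt n
  again.\<close>

lemma weighted_sum_bounded_L1:
  assumes f: "f \<in> borel_measurable borel" "\<And>y. \<bar>f y\<bar> \<le> B"
  defines "m \<equiv> expectation (\<lambda>\<omega>. f (X 1 \<omega>))"
  shows "expectation (\<lambda>\<omega>. \<bar>weighted_sum f n \<omega> - p / (2 - p) * n * m\<bar>) \<le> 4 * B * sqrt n"
proof -
  let ?c = "p / (2 - p)"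
  let ?g = "\<lambda>y. f y - m"
  let ?D = "\<lambda>\<omega>. det_walk (\<lambda>_. 1) n \<omega> - ?c * n"
  have B: "B \<ge> 0"
    using f(2)[of 0] by linarith
  have f_int: "integrable M (\<lambda>\<omega>. f (X 1 \<omega>))"
    by (rule integrable_X_bounded[OF f]) simp
  have m: "\<bar>m\<bar> \<le> B"
  proof -
    have "\<bar>m\<bar> \<le> expectation (\<lambda>\<omega>. \<bar>f (X 1 \<omega>)\<bar>)"
      unfolding m_def by (rule integral_abs_bound)
    also have "\<dots> \<le> B"
      using f_int f(2) by (intro integral_le_const) auto
    finally show ?thesis .
  qed
  have g: "?g \<in> borel_measurable borel" "\<And>y. \<bar>?g y\<bar> \<le> 2 * B"
  proof -
    show "?g \<in> borel_measurable borel"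
      using f(1) by simp
    show "\<bar>?g y\<bar> \<le> 2 * B" for y
      using abs_triangle_ineq4[of "f y" m] f(2)[of y] m by linarith
  qed
  have g_int: "integrable M (\<lambda>\<omega>. ?g (X 1 \<omega>))"
    using f_int by simp
  have "expectation (\<lambda>\<omega>. ?g (X 1 \<omega>)) = 0"
    using f_int by (simp add: m_def prob_space)
  note second = second_moment_weighted_sum_le[OF g this]
  have g_L1: "expectation (\<lambda>\<omega>. \<bar>weighted_sum ?g n \<omega>\<bar>) \<le> sqrt ((2 * B)\<^sup>2 * n)"
    by (rule expectation_abs_le_sqrt[OF weighted_sum_L1(1)[OF g(1) g_int] second])
  have D_m: "?D \<in> borel_measurable (info (past n))"
    by (intro borel_measurable_diff measurable_det_walk) auto
  have D_b: "\<bar>?D \<omega>\<bar> \<le> n + \<bar>?c * n\<bar>" for \<omega>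
    using abs_det_walk_le[of 1 "\<lambda>_. 1" n \<omega>] abs_triangle_ineq4[of "det_walk (\<lambda>_. 1) n \<omega>" "?c * n"] by simp
  have past: "past n \<subseteq> all_sources" by auto
  have D_int: "integrable M ?D" "integrable M (\<lambda>\<omega>. (?D \<omega>)\<^sup>2)"
    by (rule integrable_bounded[OF D_m past D_b] integrable_abs_sq[OF D_m past D_b])+
  have D_L1: "expectation (\<lambda>\<omega>. \<bar>?D \<omega>\<bar>) \<le> sqrt (4 * n)"
    by (rule expectation_abs_le_sqrt[OF D_int second_moment_unit_walk_le])
  have "AE \<omega> in M. \<bar>weighted_sum f n \<omega> - ?c * n * m\<bar> \<le> \<bar>weighted_sum ?g n \<omega>\<bar> + \<bar>m\<bar> * \<bar>?D \<omega>\<bar>"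
    using AE_walk_eq_sum
  proof (rule AE_mp, intro AE_I2 impI)
    fix \<omega> assume *: "\<forall>n x. det_walk x n \<omega> = (\<Sum>j=1..n. x j * weight j n \<omega>)"
    have "det_walk (\<lambda>_. 1) n \<omega> = (\<Sum>j=1..n. weight j n \<omega>)"
      using *[rule_format, of "\<lambda>_. 1" n] by simp
    then have "weighted_sum f n \<omega> - ?c * n * m = weighted_sum ?g n \<omega> + m * ?D \<omega>"
      by (simp add: left_diff_distrib sum_subtractf sum_distrib_left algebra_simps)
    then show "\<bar>weighted_sum f n \<omega> - ?c * n * m\<bar> \<le> \<bar>weighted_sum ?g n \<omega>\<bar> + \<bar>m\<bar> * \<bar>?D \<omega>\<bar>"
      using abs_triangle_ineq[of "weighted_sum ?g n \<omega>" "m * ?D \<omega>"] by (simp add: abs_mult)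
  qed
  then have "expectation (\<lambda>\<omega>. \<bar>weighted_sum f n \<omega> - ?c * n * m\<bar>) \<le>
      expectation (\<lambda>\<omega>. \<bar>weighted_sum ?g n \<omega>\<bar> + \<bar>m\<bar> * \<bar>?D \<omega>\<bar>)"
    by (intro integral_mono_AE integrable_abs Bochner_Integration.integrable_diff Bochner_Integration.integrable_add
        integrable_mult_right weighted_sum_L1(1)[OF f(1) f_int] weighted_sum_L1(1)[OF g(1) g_int] D_int(1)) auto
  also have "\<dots> = expectation (\<lambda>\<omega>. \<bar>weighted_sum ?g n \<omega>\<bar>) + \<bar>m\<bar> * expectation (\<lambda>\<omega>. \<bar>?D \<omega>\<bar>)"
    using integrable_abs[OF weighted_sum_L1(1)[OF g(1) g_int, of n]] integrable_abs[OF D_int(1)]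
    by (simp only: Bochner_Integration.integral_add integrable_mult_right integral_mult_right_zero)
  also have "\<dots> \<le> sqrt ((2 * B)\<^sup>2 * n) + B * sqrt (4 * n)"
    using g_L1 D_L1 m by (intro add_mono mult_mono) auto
  also have "\<dots> = 4 * B * sqrt n"
    using B by (simp add: real_sqrt_mult)
  finally show ?thesis .
qed

text \<open>Truncation at \<open>K\<close>. The tail is paid for twice, once in the walk itself and
  once through the shift of the mean, whose coefficient p/(2 - p) is at most 1; hence the factor
  2.\<close>

lemma walk_L1_le:
  assumes X: "integrable M (X 1)" and n: "n \<ge> 1" and K: "K \<ge> 0"
  shows "integrable M (\<lambda>\<omega>. counterbalanced_walk X \<epsilon> v n \<omega> / n - p / (2 - p) * expectation (X 1))"
    and "expectation (\<lambda>\<omega>. \<bar>counterbalanced_walk X \<epsilon> v n \<omega> / n - p / (2 - p) * expectation (X 1)\<bar>) \<le>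
      4 * K / sqrt n + 2 * expectation (\<lambda>\<omega>. if \<bar>X 1 \<omega>\<bar> \<le> K then 0 else \<bar>X 1 \<omega>\<bar>)"
proof -
  let ?c = "p / (2 - p)"
  define f g where "f y = (if \<bar>y\<bar> \<le> K then y else 0)" and "g y = (if \<bar>y\<bar> \<le> K then 0 else y)" for y :: real
  have f: "f \<in> borel_measurable borel" "\<And>y. \<bar>f y\<bar> \<le> K" and g: "g \<in> borel_measurable borel"
    using K unfolding f_def[abs_def] g_def[abs_def] by auto
  have fg: "y = f y + g y" "g y = y - f y" for y
    by (simp_all add: f_def g_def)
  define \<eta> where "\<eta> = expectation (\<lambda>\<omega>. \<bar>g (X 1 \<omega>)\<bar>)"
  have f_int: "integrable M (\<lambda>\<omega>. f (X 1 \<omega>))"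
    by (rule integrable_X_bounded[OF f]) simp
  have g_int: "integrable M (\<lambda>\<omega>. g (X 1 \<omega>))"
    using Bochner_Integration.integrable_diff[OF X f_int] by (simp add: fg(2))
  define m where "m = expectation (\<lambda>\<omega>. f (X 1 \<omega>))"
  have "expectation (X 1) = expectation (\<lambda>\<omega>. f (X 1 \<omega>) + g (X 1 \<omega>))"
    using fg(1) by (intro Bochner_Integration.integral_cong) auto
  then have "expectation (X 1) - m = expectation (\<lambda>\<omega>. g (X 1 \<omega>))"
    using f_int g_int by (simp add: m_def)
  then have m: "\<bar>expectation (X 1) - m\<bar> \<le> \<eta>"
    unfolding \<eta>_def by (simp add: integral_abs_bound)
  have c: "0 \<le> ?c" "?c \<le> 1"
    using p_range by auto
  have walk: "AE \<omega> in M. counterbalanced_walk X \<epsilon> v n \<omega> = weighted_sum (\<lambda>y. y) n \<omega>"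
    using AE_counterbalanced_walk_eq by auto
  have "integrable M (counterbalanced_walk X \<epsilon> v n)"
    using weighted_sum_L1(1)[of "\<lambda>y. y" n] X walk counterbalanced_walk_measurable
    by (subst integrable_cong_AE[OF _ _ walk]) auto
  then show W_int: "integrable M (\<lambda>\<omega>. counterbalanced_walk X \<epsilon> v n \<omega> / n - ?c * expectation (X 1))"
    by simp
  have f_w: "integrable M (weighted_sum f n)" and g_w: "integrable M (weighted_sum g n)"
    by (rule weighted_sum_L1(1)[OF f(1) f_int] weighted_sum_L1(1)[OF g g_int])+
  \<comment> \<open>Replaces the full mean E by the truncated mean \<open>m\<close>: the three terms
    are the bounded part with its own centring, the tail of the walk, and the shift of the
    mean.\<close>
  have split: "(a + b) / n - c * E = (a - c * n * m) / n + b / n - c * (E - m)" for a b c E :: real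
    using n by (simp add: field_simps)
  let ?R = "\<lambda>\<omega>. \<bar>weighted_sum f n \<omega> - ?c * n * m\<bar> / n + \<bar>weighted_sum g n \<omega>\<bar> / n + \<eta>"
  have "expectation (\<lambda>\<omega>. \<bar>counterbalanced_walk X \<epsilon> v n \<omega> / n - ?c * expectation (X 1)\<bar>) \<le> expectation ?R"
  proof (rule integral_mono_AE)
    show "AE \<omega> in M. \<bar>counterbalanced_walk X \<epsilon> v n \<omega> / n - ?c * expectation (X 1)\<bar> \<le> ?R \<omega>"
      using walk
    proof (rule AE_mp, intro AE_I2 impI)
      fix \<omega> assume *: "counterbalanced_walk X \<epsilon> v n \<omega> = weighted_sum (\<lambda>y. y) n \<omega>"
      have "weighted_sum (\<lambda>y. y) n \<omega> = weighted_sum f n \<omega> + weighted_sum g n \<omega>"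
        unfolding sum.distrib[symmetric] distrib_right[symmetric] fg(1)[symmetric] ..
      then have eq: "counterbalanced_walk X \<epsilon> v n \<omega> / n - ?c * expectation (X 1) =
          (weighted_sum f n \<omega> - ?c * n * m) / n + weighted_sum g n \<omega> / n - ?c * (expectation (X 1) - m)"
        unfolding * by (simp only: split)
      have "\<bar>?c * (expectation (X 1) - m)\<bar> \<le> 1 * \<eta>"
        unfolding abs_mult using c by (intro mult_mono m) (simp_all only: abs_of_nonneg abs_ge_zero)
      moreover have "\<bar>a / n + b / n - d\<bar> \<le> \<bar>a\<bar> / n + \<bar>b\<bar> / n + \<eta>" if "\<bar>d\<bar> \<le> 1 * \<eta>" for a b d :: real
      proof -
        have "\<bar>a / n\<bar> = \<bar>a\<bar> / n" "\<bar>b / n\<bar> = \<bar>b\<bar> / n"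
          by simp_all
        then show ?thesis
          using that by linarith
      qed
      ultimately show "\<bar>counterbalanced_walk X \<epsilon> v n \<omega> / n - ?c * expectation (X 1)\<bar> \<le> ?R \<omega>"
        unfolding eq by blast
    qed
  qed (use W_int f_w g_w in auto)
  also have "\<dots> = expectation (\<lambda>\<omega>. \<bar>weighted_sum f n \<omega> - ?c * n * m\<bar>) / n
      + expectation (\<lambda>\<omega>. \<bar>weighted_sum g n \<omega>\<bar>) / n + \<eta>"
    using f_w g_w by (simp add: prob_space)
  also have "\<dots> \<le> 4 * K * sqrt n / n + n * \<eta> / n + \<eta>"
    using weighted_sum_bounded_L1[OF f, of n] weighted_sum_L1(2)[OF g g_int, of n]
    unfolding m_def[symmetric] \<eta>_def[symmetric] by (intro add_mono divide_right_mono) auto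
  also have "\<dots> = 4 * K / sqrt n + 2 * \<eta>"
    using n by (simp add: field_simps)
  also have "\<eta> = expectation (\<lambda>\<omega>. if \<bar>X 1 \<omega>\<bar> \<le> K then 0 else \<bar>X 1 \<omega>\<bar>)"
    unfolding \<eta>_def g_def by (intro Bochner_Integration.integral_cong) auto
  finally show "expectation (\<lambda>\<omega>. \<bar>counterbalanced_walk X \<epsilon> v n \<omega> / n - ?c * expectation (X 1)\<bar>) \<le>
      4 * K / sqrt n + 2 * expectation (\<lambda>\<omega>. if \<bar>X 1 \<omega>\<bar> \<le> K then 0 else \<bar>X 1 \<omega>\<bar>)" .
qed

text \<open>At each sample point the integrand is 0 as soon as the level exceeds |X_1|, and |X_1|
  itself dominates.\<close>

lemma tail_expectation_tendsto_0:
  assumes "integrable M (X 1)"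
  shows "(\<lambda>K. expectation (\<lambda>\<omega>. if \<bar>X 1 \<omega>\<bar> \<le> real K then 0 else \<bar>X 1 \<omega>\<bar>)) \<longlonglongrightarrow> 0"
proof -
  have [measurable]: "X 1 \<in> borel_measurable M"
    using assms by auto
  have "(\<lambda>K. expectation (\<lambda>\<omega>. if \<bar>X 1 \<omega>\<bar> \<le> real K then 0 else \<bar>X 1 \<omega>\<bar>)) \<longlonglongrightarrow> expectation (\<lambda>_. 0)"
  proof (rule integral_dominated_convergence[where w = "\<lambda>\<omega>. \<bar>X 1 \<omega>\<bar>"])
    show "AE \<omega> in M. (\<lambda>K. if \<bar>X 1 \<omega>\<bar> \<le> real K then 0 else \<bar>X 1 \<omega>\<bar>) \<longlonglongrightarrow> 0"
    proof (rule AE_I2, rule tendsto_eventually)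
      fix \<omega>
      show "\<forall>\<^sub>F K in sequentially. (if \<bar>X 1 \<omega>\<bar> \<le> real K then 0 else \<bar>X 1 \<omega>\<bar>) = 0"
        using eventually_ge_at_top[of "nat \<lceil>\<bar>X 1 \<omega>\<bar>\<rceil>"] by eventually_elim (simp add: nat_ceiling_le_eq)
    qed
  qed (use assms in auto)
  then show ?thesis by simp
qed

lemma walk_L1_tendsto_0:
  assumes X: "integrable M (X 1)"
  shows "(\<lambda>n. expectation (\<lambda>\<omega>. \<bar>counterbalanced_walk X \<epsilon> v n \<omega> / n - p / (2 - p) * expectation (X 1)\<bar>)) \<longlonglongrightarrow> 0"
    (is "?a \<longlonglongrightarrow> 0")
proof (rule LIMSEQ_I)
  fix e :: real assume e: "e > 0"
  \<comment> \<open>The level is fixed before \<open>n\<close>: the tail enters with factor 2, so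
    e/4 leaves e/2 for the term of order 1/sqrt n.\<close>
  obtain K :: nat where K: "\<bar>expectation (\<lambda>\<omega>. if \<bar>X 1 \<omega>\<bar> \<le> real K then 0 else \<bar>X 1 \<omega>\<bar>)\<bar> < e / 4"
    using LIMSEQ_D[OF tail_expectation_tendsto_0[OF X], of "e / 4"] e by auto
  have "(\<lambda>n. 4 * real K / sqrt (real n)) \<longlonglongrightarrow> 0"
    by (intro tendsto_divide_0[OF tendsto_const] filterlim_at_top_imp_at_infinity
        filterlim_compose[OF sqrt_at_top] filterlim_real_sequentially)
  then have "\<forall>\<^sub>F n in sequentially. 4 * real K / sqrt (real n) < e / 2"
    using e by (intro order_tendstoD(2)) auto
  then have "\<forall>\<^sub>F n in sequentially. norm (?a n - 0) < e"
    using eventually_ge_at_top[of 1]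
  proof eventually_elim
    case (elim n)
    have "?a n \<le> 4 * real K / sqrt n + 2 * expectation (\<lambda>\<omega>. if \<bar>X 1 \<omega>\<bar> \<le> real K then 0 else \<bar>X 1 \<omega>\<bar>)"
      using walk_L1_le(2)[OF X elim(2), of "real K"] by simp
    moreover have "?a n \<ge> 0"
      by simp
    ultimately show ?case
      using K elim(1) by (simp only: real_norm_def)
  qed
  then show "\<exists>no. \<forall>n\<ge>no. norm (?a n - 0) < e"
    by (simp add: eventually_sequentially)
qed

end

theorem proposition1p1:
  fixes M :: "'a measure" and \<mu> :: "real measure" and p m\<^sub>1 :: real
    and X :: "nat \<Rightarrow> 'a \<Rightarrow> real" and \<epsilon> v :: "nat \<Rightarrow> 'a \<Rightarrow> nat"
  assumes "counterbalanced_setting M \<mu> p X \<epsilon> v"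
    and "integrable M (X 1)"
    and "m\<^sub>1 = integral\<^sup>L M (X 1)"
  shows "tendsto_in_probability M
           (\<lambda>n \<omega>. counterbalanced_walk X \<epsilon> v n \<omega> / real n)
           (\<lambda>_. p / (2 - p) * m\<^sub>1)"
proof -
  interpret counterbalanced_setting M \<mu> p X \<epsilon> v by fact
  let ?Y = "\<lambda>n \<omega>. \<bar>counterbalanced_walk X \<epsilon> v n \<omega> / real n - p / (2 - p) * m\<^sub>1\<bar>"
  have walk: "(\<lambda>\<omega>. counterbalanced_walk X \<epsilon> v n \<omega> / real n) \<in> borel_measurable M" for n
    using counterbalanced_walk_measurable by simp
  have Y_m [measurable]: "?Y n \<in> borel_measurable M" for n
    using walk by simp
  have "(\<lambda>n. measure M {\<omega> \<in> space M. ?Y n \<omega> > \<delta>}) \<longlonglongrightarrow> 0" if \<delta>: "\<delta> > 0" for \<delta>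
  \<comment> \<open>Markov's inequality reduces the claim to convergence in L1. It is used only for
    n \<ge> 1, where the L1 estimates are available, so the bound is stated as an eventual
    one.\<close>
  proof (rule tendsto_sandwich[OF _ _ tendsto_const])
    show "\<forall>\<^sub>F n in sequentially. measure M {\<omega> \<in> space M. ?Y n \<omega> > \<delta>} \<le> expectation (?Y n) / \<delta>"
      using eventually_ge_at_top[of 1]
    proof eventually_elim
      case (elim n)
      have "measure M {\<omega> \<in> space M. ?Y n \<omega> > \<delta>} \<le> measure M {\<omega> \<in> space M. ?Y n \<omega> \<ge> \<delta>}"
        by (rule finite_measure_mono[OF Collect_mono borel_measurable_le[OF borel_measurable_const Y_m]]) simp
      also have "\<dots> \<le> expectation (?Y n) / \<delta>"
      proof (rule integral_Markov_inequality_measure[where A = "{}"])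
        show "integrable M (?Y n)"
          \<comment> \<open>Integrability does not involve the truncation level;
            \<open>order_refl\<close> fixes that level at 0.\<close>
          unfolding assms(3) by (rule integrable_abs[OF walk_L1_le(1)[OF assms(2) elim order_refl]])
      qed (use \<delta> in auto)
      finally show ?case .
    qed
    show "(\<lambda>n. expectation (?Y n) / \<delta>) \<longlonglongrightarrow> 0"
      using tendsto_divide[OF walk_L1_tendsto_0[OF assms(2)] tendsto_const, of \<delta>] \<delta> assms(3) by simp
  qed auto
  with walk show ?thesis
    by (simp add: tendsto_in_probability_def)
qed

end
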